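(* Let $G=\frac{1+\sqrt5}2$, $\lambda\in\left(\frac{2}{3+\sqrt5},\frac12\right)$, $\beta=\log\left(\frac{1-\lambda}{\lambda}\right)/\log G\in(0,1)$, and let $f=f_\lambda$ be the countably piecewise linear Fibonacci unimodal map, $F=f^\sigma$ its induced map, and $F^\rho=(f^\sigma)^\rho=f^\tau:\hat V_1\to\hat V_1$ the first return map of $F$ to $\hat V_1$ (see context), with invariant measure $\mu_{\hat\phi}$. Then there are constants $0<C_2<C_1$ such that for all $n\ge 1$ $$C_2n^{-\beta}\le\mu_{\hat\phi}(\tau>n)\le C_1n^{-\beta}.$$
   Context: Fibonacci unimodal maps: let $S_0,S_1,S_2,S_3,S_4,\dots=1,2,3,5,8,\dots$ be the Fibonacci numbers. A Fibonacci unimodal map $f$ of the interval with critical point $c=\frac12$ has precritical points $z_k\nearrow c$ and $\hat z_k\searrow c$ such that $f^{S_k}$ maps both $[z_k,c]$ and $[c,\hat z_k]$ monotonically onto the interval between $c$ and $f^{S_k}(c)$ (so $f^{S_k}(z_k)=f^{S_k}(\hat z_k)=c$), whereas $f^{S_k}(z_{k+1})=f^{S_k}(\hat z_{k+1})\in\{z_{k-1},\hat z_{k-1}\}$. The induced map is $F=f^\sigma$ with $\sigma(x)=S_k$ for $x\in\hat V_{k+1}:=[z_k,z_{k+1})\cup(\hat z_{k+1},\hat z_k]$, $k\ge0$. For each $\lambda\in(0,1)$ there is (Bruin–Todd) a countably piecewise linear Fibonacci map $f_\lambda$, linear on each $[z_k,z_{k+1})$ and $(\hat z_{k+1},\hat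 z_k]$, with $|z_k-c|=|\hat z_k-c|=\frac12\lambda^k$ (up to affine normalisation) and such that the induced map $F_\lambda=f_\lambda^\sigma$ is linear on each of these intervals, with slope of absolute value $\lambda^{-1}(1-\lambda)^{-1}$ on those contained in $[z_1,\hat z_1]$ and $(1-\lambda)^{-1}$ on the two components of $\hat V_1$. $F_\lambda$ is two-to-one semiconjugate to $T_\lambda$ on $(0,1]$, $T_\lambda(x)=\frac{1-x}{1-\lambda}$ on $(\lambda,1]$, $T_\lambda(x)=\frac{\lambda^{n-1}-x}{\lambda(1-\lambda)}$ on $(\lambda^n,\lambda^{n-1}]$, $n\ge2$. Let $\phi=-\log|f_\lambda'|$, $\bar\phi=\sum_{j=0}^{\sigma-1}\phi\circ f^j=-\log|F'|$, and $\mu_{\bar\phi}$ the equilibrium measure of $\bar\phi$ for $F$ (absolutely continuous; $\mu_{\bar\phi}(\sigma=S_k)=\frac{1-2\lambda}{1-\lambda}\left(\frac{\lambda}{1-\lambda}\right)^k$). For $y\in\hat V_1=[z_0,z_1)\cup(\hat z_1,\hat z_0]$ let $\rho(y)=\min\{n\ge1:F^n(y)\in\hat V_1\}$ and $\tau(y)=\sum_{j=0}^{\rho(y)-1}\sigma(F^jy)$. Then $\hat F=F^\rho=f^\tau:\hat V_1\to\hat V_1$ is Markov with linear branches each onto a component of $\hat V_1$, and $\mu_{\hat\phi}$ is its absolutely continuous invariant probability measure, i.e. the equilibrium measure of $\hat\phi=\sum_{j=0}^{\rho-1}\bar\phi\circ F^j=-\log|\hat F'|$. *)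

theory Defs
  imports "HOL-Probability.Probability" "HOL-Number_Theory.Fib"
begin

definition crit :: real where
  "crit = 1/2"

text \<open>1, 2, 3, 5, 8, ...; the library sequence \<^const>\<open>fib\<close> starts with 0, 1, 1.\<close>

definition S :: "nat \<Rightarrow> nat" where
  "S k = fib (k + 2)"

definition unimodal_map :: "real \<Rightarrow> real \<Rightarrow> (real \<Rightarrow> real) \<Rightarrow> bool" where
  "unimodal_map a b f \<longleftrightarrow>
     a < crit \<and> crit < b \<and> continuous_on {a..b} f \<and> f ` {a..b} \<subseteq> {a..b} \<and>
     strict_mono_on {a..crit} f \<and> strict_antimono_on {crit..b} f"

definition monotone_onto :: "(real \<Rightarrow> real) \<Rightarrow> real set \<Rightarrow> real set \<Rightarrow> bool" where
  "monotone_onto g A B \<longleftrightarrow> (mono_on A g \<or> antimono_on A g) \<and> g ` A = B"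

text \<open>
  The phase space [a, b] is in general strictly larger than [z 0, zh 0]: for a Fibonacci
  map f(crit) > zh 0 and f(f(crit)) < z 0.  In the last clause the case k = 0 is left out,
  as there is no z (-1); the value f (z 1) = f (zh 1) = zh 0 follows from the other clauses.
\<close>

definition fibonacci_unimodal ::
    "real \<Rightarrow> real \<Rightarrow> (real \<Rightarrow> real) \<Rightarrow> (nat \<Rightarrow> real) \<Rightarrow> (nat \<Rightarrow> real) \<Rightarrow> bool" where
  "fibonacci_unimodal a b f z zh \<longleftrightarrow>
     unimodal_map a b f \<and>
     range z \<subseteq> {a..b} \<and> range zh \<subseteq> {a..b} \<and>
     (\<forall>k. z k < z (Suc k)) \<and> z \<longlonglongrightarrow> crit \<and>
     (\<forall>k. zh (Suc k) < zh k) \<and> zh \<longlonglongrightarrow> crit \<and>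
     (\<forall>k. monotone_onto (f ^^ S k) {z k..crit} (closed_segment crit ((f ^^ S k) crit)) \<and>
          monotone_onto (f ^^ S k) {crit..zh k} (closed_segment crit ((f ^^ S k) crit))) \<and>
     (\<forall>k\<ge>1. (f ^^ S k) (z (k + 1)) = (f ^^ S k) (zh (k + 1)) \<and>
             (f ^^ S k) (z (k + 1)) \<in> {z (k - 1), zh (k - 1)})"

text \<open>Only used for n at least 1.\<close>

definition Vhat :: "(nat \<Rightarrow> real) \<Rightarrow> (nat \<Rightarrow> real) \<Rightarrow> nat \<Rightarrow> real set" where
  "Vhat z zh n = {z (n - 1)..<z n} \<union> {zh n<..zh (n - 1)}"

text \<open>
  Outside the union of the sets Vhat z zh (k + 1), in particular at the critical point, where
  the inducing time is not defined, it is set to 0, so that the induced map fixes those points.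
\<close>

definition sigma :: "(nat \<Rightarrow> real) \<Rightarrow> (nat \<Rightarrow> real) \<Rightarrow> real \<Rightarrow> nat" where
  "sigma z zh x =
     (if \<exists>k. x \<in> Vhat z zh (k + 1) then S (THE k. x \<in> Vhat z zh (k + 1)) else 0)"

definition induced_map ::
    "(real \<Rightarrow> real) \<Rightarrow> (nat \<Rightarrow> real) \<Rightarrow> (nat \<Rightarrow> real) \<Rightarrow> real \<Rightarrow> real" where
  "induced_map f z zh x = (f ^^ sigma z zh x) x"

definition linear_with_slope :: "real \<Rightarrow> (real \<Rightarrow> real) \<Rightarrow> real set \<Rightarrow> bool" where
  "linear_with_slope s g A \<longleftrightarrow> (\<exists>t. \<forall>x\<in>A. g x = s * x + t)"

definition pl_fibonacci ::
    "real \<Rightarrow> real \<Rightarrow> real \<Rightarrow> (real \<Rightarrow> real) \<Rightarrow> (nat \<Rightarrow> real) \<Rightarrow> (nat \<Rightarrow> real) \<Rightarrow> bool" where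
  "pl_fibonacci lam a b f z zh \<longleftrightarrow>
     fibonacci_unimodal a b f z zh \<and>
     (\<forall>k. \<bar>z k - crit\<bar> = lam ^ k / 2 \<and> \<bar>zh k - crit\<bar> = lam ^ k / 2) \<and>
     (\<forall>k. \<forall>J \<in> {{z k..<z (k + 1)}, {zh (k + 1)<..zh k}}.
        (\<exists>s. linear_with_slope s f J) \<and>
        (\<exists>s. \<bar>s\<bar> = (if k = 0 then 1 / (1 - lam) else 1 / (lam * (1 - lam))) \<and>
             linear_with_slope s (induced_map f z zh) J))"

text \<open>
  Points that never return get return time 0, hence are fixed by the return map below.  They
  form a Lebesgue null set in the parameter range of interest, so the convention does not affect
  absolutely continuous measures.
\<close>

definition rho ::
    "(real \<Rightarrow> real) \<Rightarrow> (nat \<Rightarrow> real) \<Rightarrow> (nat \<Rightarrow> real) \<Rightarrow> real \<Rightarrow> nat" where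
  "rho f z zh y =
     (if \<exists>n\<ge>1. (induced_map f z zh ^^ n) y \<in> Vhat z zh 1
      then LEAST n. n \<ge> 1 \<and> (induced_map f z zh ^^ n) y \<in> Vhat z zh 1 else 0)"

definition tau ::
    "(real \<Rightarrow> real) \<Rightarrow> (nat \<Rightarrow> real) \<Rightarrow> (nat \<Rightarrow> real) \<Rightarrow> real \<Rightarrow> nat" where
  "tau f z zh y = (\<Sum>j<rho f z zh y. sigma z zh ((induced_map f z zh ^^ j) y))"

definition return_map ::
    "(real \<Rightarrow> real) \<Rightarrow> (nat \<Rightarrow> real) \<Rightarrow> (nat \<Rightarrow> real) \<Rightarrow> real \<Rightarrow> real" where
  "return_map f z zh y = (induced_map f z zh ^^ rho f z zh y) y"

text \<open>Absolutely continuous invariant probability measures of a map of X into itself.\<close>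

definition acip :: "real set \<Rightarrow> (real \<Rightarrow> real) \<Rightarrow> real measure \<Rightarrow> bool" where
  "acip X T mu \<longleftrightarrow>
     prob_space mu \<and> sets mu = sets (restrict_space lborel X) \<and>
     absolutely_continuous (restrict_space lborel X) mu \<and>
     T \<in> measurable mu mu \<and> distr mu mu T = mu"

end

theory Submission
  imports Defs
begin

text \<open>
  Folding at the critical point, x = |2 y - 1|, turns the induced map into a map T of (0, 1] that
  is affine on each cell (l^(k+1), l^k], with image [0, l^(k-1)) for k at least 1 and [0, 1) for
  k = 0.  Hence under Lebesgue measure the cell index is a random walk with steps Geometric - 1,
  which drifts downwards because l < 1/2, and tau sums the Fibonacci number of the current
  cell over an excursion away from cell 0.

  Let q = l / (1 - l), so that n^(-beta) is q^K for n = G^K.  T has an invariant density that gives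
  cell k a mass proportional to q^k; unfolding the invariance along excursions bounds the expected
  sum of any nonnegative function over an excursion by its integral against that density.  This
  yields almost sure return and, applied to the Fibonacci weights truncated at the cell K with
  G^K about n, the upper bound.  The lower bound is the gambler's ruin estimate: an
  excursion reaches cell K with probability at least a multiple of q^K, and then tau exceeds the
  K-th Fibonacci number.

  Since T after the excursion is again uniformly distributed on cell 0 and independent of tau,
  the events tau > n along the orbit are pairwise independent under Lebesgue measure.  The weak law
  of large numbers along an almost surely convergent subsequence then forces every absolutely
  continuous invariant probability measure to give {tau > n} its Lebesgue probability.
\<close>

section \<open>The folded map and its invariant density\<close>

locale folded_map =
  fixes l :: real
  assumes l_pos: "0 < l" and l_less_half: "l < 1/2"
begin

lemma l_less_1: "l < 1"
  using l_less_half by simp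

section \<open>Cells, levels and the affine branches of the folded map\<close>

definition cell :: "nat \<Rightarrow> real set" where
  "cell k = {l ^ Suc k<..l ^ k}"

definition level :: "real \<Rightarrow> nat" where
  "level x = (LEAST k. l ^ Suc k < x)"

text \<open>The reciprocal of the absolute slope on a cell. With truncated subtraction the image of
  cell k has length \<open>l ^ (k - 1)\<close> for every k, so cells 0 and 1 both have an image of
  full length.\<close>

definition width :: "nat \<Rightarrow> real" where
  "width k = (if k = 0 then 1 - l else l * (1 - l))"

text \<open>The identity outside (0, 1] matches the value 0 of \<open>sigma\<close> there, so that
  the semiconjugacy \<open>fold_induced_map\<close> holds at every point.\<close>

definition T :: "real \<Rightarrow> real" where
  "T x = (if 0 < x \<and> x \<le> 1 then (l ^ level x - x) / width (level x) else x)"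

definition cost :: "real \<Rightarrow> nat" where
  "cost x = (if 0 < x \<and> x \<le> 1 then S (level x) else 0)"

lemma power_le_power_iff: "l ^ i \<le> l ^ j \<longleftrightarrow> j \<le> i"
  using power_decreasing_iff l_pos l_less_1 by blast

lemma ex_power_less: "0 < x \<Longrightarrow> \<exists>k. l ^ Suc k < x"
proof -
  assume "0 < x"
  then obtain n where "l ^ n < x"
    using real_arch_pow_inv[OF _ l_less_1] by blast
  moreover have "l ^ Suc n \<le> l ^ n"
    using power_le_power_iff[of "Suc n" n] by (simp del: power_Suc)
  ultimately show ?thesis by (metis order.strict_trans1)
qed

lemma in_cell_iff: "x \<in> cell k \<longleftrightarrow> 0 < x \<and> x \<le> 1 \<and> level x = k"
proof
  assume x: "x \<in> cell k"
  have "level x = k"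
    unfolding level_def
  proof (rule Least_equality)
    show "l ^ Suc k < x" using x by (simp add: cell_def)
    fix j assume "l ^ Suc j < x"
    with x have "l ^ Suc j < l ^ k" by (simp add: cell_def del: power_Suc)
    then show "k \<le> j"
      by (metis power_le_power_iff not_less_eq_eq not_le)
  qed
  moreover have "0 < x" using x l_pos
    by (metis cell_def greaterThanAtMost_iff order.strict_trans zero_less_power)
  moreover have "x \<le> 1" using x power_le_power_iff[of k 0] by (simp add: cell_def)
  ultimately show "0 < x \<and> x \<le> 1 \<and> level x = k" by blast
next
  assume x: "0 < x \<and> x \<le> 1 \<and> level x = k"
  have *: "l ^ Suc k < x"
    using LeastI_ex[OF ex_power_less[of x]] x by (simp add: level_def)
  have "x \<le> l ^ k"
  proof (cases k)
    case (Suc j)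
    have "\<not> l ^ Suc j < x"
      using not_less_Least[of j "\<lambda>k. l ^ Suc k < x"] x Suc by (simp add: level_def)
    then show ?thesis using Suc by simp
  qed (use x in simp)
  with * show "x \<in> cell k" by (simp add: cell_def)
qed

lemma disjoint_family_cell: "disjoint_family (\<lambda>j. cell (k + j))"
  by (auto simp: disjoint_family_on_def in_cell_iff)

lemma level_ge_iff: "0 < x \<Longrightarrow> x \<le> 1 \<Longrightarrow> k \<le> level x \<longleftrightarrow> x \<le> l ^ k"
proof -
  assume x: "0 < x" "x \<le> 1"
  then have "x \<in> cell (level x)" by (simp add: in_cell_iff)
  then have *: "l ^ Suc (level x) < x" "x \<le> l ^ level x" by (auto simp: cell_def)
  show ?thesis
  proof
    assume "k \<le> level x"
    then show "x \<le> l ^ k" using *(2) power_le_power_iff by (meson order.trans)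
  next
    assume "x \<le> l ^ k"
    with *(1) have "\<not> l ^ k \<le> l ^ Suc (level x)" by linarith
    then show "k \<le> level x" unfolding power_le_power_iff by simp
  qed
qed

lemma power_le_1: "l ^ k \<le> 1"
  using l_pos l_less_1 by (simp add: power_le_one)

lemma UN_cell: "(\<Union>j. cell (k + j)) = {0<..l ^ k}"
proof (intro set_eqI iffI)
  fix x assume "x \<in> (\<Union>j. cell (k + j))"
  then obtain j where "0 < x" "x \<le> 1" "level x = k + j"
    by (auto simp: in_cell_iff)
  then show "x \<in> {0<..l ^ k}" using level_ge_iff[of x k] by simp
next
  fix x assume x: "x \<in> {0<..l ^ k}"
  then have "x \<le> 1" using power_le_1[of k] by simp
  with x have "x \<in> cell (k + (level x - k))" using level_ge_iff[of x k] by (simp add: in_cell_iff)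
  then show "x \<in> (\<Union>j. cell (k + j))" by blast
qed

lemma width_pos: "0 < width k"
  using l_pos l_less_1 by (simp add: width_def)

lemma width_times_power: "width k * l ^ (k - 1) = l ^ k - l ^ Suc k"
  by (cases k) (auto simp: width_def algebra_simps)

lemma cell_sets [measurable]: "cell k \<in> sets borel"
  by (simp add: cell_def)

lemma emeasure_cell: "emeasure lborel (cell k) = ennreal (l ^ k - l ^ Suc k)"
  using power_le_power_iff[of "Suc k" k] by (simp add: cell_def)

lemma measurable_level [measurable]: "level \<in> borel \<rightarrow>\<^sub>M count_space UNIV"
  unfolding level_def[abs_def] by measurable

lemma measurable_T [measurable]: "T \<in> borel_measurable borel"
proof -
  have [measurable]: "(\<lambda>x. l ^ level x) \<in> borel_measurable borel"
    "(\<lambda>x. width (level x)) \<in> borel_measurable borel"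
    by (auto intro: measurable_compose[OF measurable_level])
  show ?thesis unfolding T_def[abs_def] by measurable
qed

lemma measurable_cost [measurable]: "cost \<in> borel \<rightarrow>\<^sub>M count_space UNIV"
proof -
  have [measurable]: "(\<lambda>x. S (level x)) \<in> borel \<rightarrow>\<^sub>M count_space UNIV"
    by (auto intro: measurable_compose[OF measurable_level])
  show ?thesis unfolding cost_def[abs_def] by measurable
qed

lemma measurable_T_funpow [measurable]: "T ^^ m \<in> borel_measurable borel"
  by (induction m) (auto intro: measurable_comp)

lemma in_cell_iff_branch:
  "x \<in> cell k \<longleftrightarrow> (l ^ k - x) / width k \<in> {0..<l ^ (k - 1)}"
  using width_times_power[of k] width_pos[of k]
  by (auto simp: cell_def field_simps)

text \<open>Affine change of variables on one branch. Probabilistically, T x is uniform on (0,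
  l^(k-1)] when x is uniform on cell k; this is the Markov property of the level. The two half-open
  intervals differ by a null set.\<close>

lemma nn_integral_cell:
  assumes [measurable]: "\<psi> \<in> borel_measurable borel"
  shows "(\<integral>\<^sup>+x. \<psi> (T x) * indicator (cell k) x \<partial>lborel) =
    ennreal (width k) * (\<integral>\<^sup>+x. \<psi> x * indicator {0<..l ^ (k - 1)} x \<partial>lborel)"
proof -
  let ?w = "width k"
  have w: "?w > 0" by (rule width_pos)
  have "(\<integral>\<^sup>+x. \<psi> x * indicator {0<..l ^ (k - 1)} x \<partial>lborel) =
        (\<integral>\<^sup>+x. \<psi> x * indicator {0..<l ^ (k - 1)} x \<partial>lborel)"
    by (rule nn_integral_cong_AE,
        use AE_lborel_singleton[of 0] AE_lborel_singleton[of "l ^ (k - 1)"] in eventually_elim)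
       (auto simp: indicator_def)
  also have "\<dots> = ennreal \<bar>-1 / ?w\<bar> *
     (\<integral>\<^sup>+x. \<psi> (l ^ k / ?w + -1 / ?w * x) * indicator {0..<l ^ (k - 1)} (l ^ k / ?w + -1 / ?w * x) \<partial>lborel)"
    using w by (subst nn_integral_real_affine[where c = "-1 / ?w" and t = "l ^ k / ?w"]) auto
  also have "(\<integral>\<^sup>+x. \<psi> (l ^ k / ?w + -1 / ?w * x) * indicator {0..<l ^ (k - 1)} (l ^ k / ?w + -1 / ?w * x) \<partial>lborel)
      = (\<integral>\<^sup>+x. \<psi> (T x) * indicator (cell k) x \<partial>lborel)"
  proof (intro nn_integral_cong)
    fix x
    have eq: "l ^ k / ?w + -1 / ?w * x = (l ^ k - x) / ?w" by (simp add: diff_divide_distrib)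
    show "\<psi> (l ^ k / ?w + -1 / ?w * x) * indicator {0..<l ^ (k - 1)} (l ^ k / ?w + -1 / ?w * x)
      = \<psi> (T x) * indicator (cell k) x"
      unfolding eq using in_cell_iff_branch[of x k] by (auto simp: indicator_def T_def in_cell_iff)
  qed
  finally have "ennreal ?w * (\<integral>\<^sup>+x. \<psi> x * indicator {0<..l ^ (k - 1)} x \<partial>lborel) =
    (ennreal ?w * ennreal \<bar>-1 / ?w\<bar>) * (\<integral>\<^sup>+x. \<psi> (T x) * indicator (cell k) x \<partial>lborel)"
    by (simp add: mult.assoc)
  also have "ennreal ?w * ennreal \<bar>-1 / ?w\<bar> = 1"
    using w by (simp flip: ennreal_mult)
  finally show ?thesis by simp
qed

section \<open>The invariant density of the folded map\<close>

definition dens :: "real \<Rightarrow> ennreal" where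
  "dens x = ennreal ((1 / (1 - l)) ^ level x) * indicator {0<..1} x"

lemma measurable_dens [measurable]: "dens \<in> borel_measurable borel"
proof -
  have [measurable]: "(\<lambda>x. (1 / (1 - l)) ^ level x) \<in> borel_measurable borel"
    by (auto intro: measurable_compose[OF measurable_level])
  show ?thesis unfolding dens_def[abs_def] by measurable
qed

lemma dens_cell: "x \<in> cell k \<Longrightarrow> dens x = ennreal ((1 / (1 - l)) ^ k)"
  by (auto simp: dens_def in_cell_iff)

lemma dens_eq_suminf_cell:
  "dens x = (\<Sum>k. ennreal ((1 / (1 - l)) ^ k) * indicator (cell k) x)"
proof (cases "0 < x \<and> x \<le> 1")
  case True
  then have "x \<in> cell (level x)" by (simp add: in_cell_iff)
  then show ?thesis
    using disjoint_family_cell[of 0] suminf_cmult_indicator[of cell x "level x"] dens_cell by simp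
next
  case False
  then have "x \<notin> cell k" for k by (auto simp: in_cell_iff)
  with False show ?thesis by (auto simp: dens_def)
qed

text \<open>The fixed-point equation of the transfer operator: a point of cell j has preimages
  exactly in the cells 0 to j + 1, each weighted by the density there times the reciprocal
  slope.\<close>

lemma sum_width:
  "(\<Sum>k\<le>Suc j. (1 / (1 - l)) ^ k * width k) = (1 / (1 - l)) ^ j"
proof (induction j)
  case 0
  then show ?case using l_less_1 by (simp add: width_def field_simps)
next
  case (Suc j)
  have "(\<Sum>k\<le>Suc (Suc j). (1 / (1 - l)) ^ k * width k)
     = (1 / (1 - l)) ^ j + (1 / (1 - l)) ^ Suc (Suc j) * width (Suc (Suc j))"
    using Suc by simp
  also have "\<dots> = (1 / (1 - l)) ^ Suc j"
  proof -
    \<comment> \<open>For x = r^j the new summand is r l x because r (1 - l) = 1, and 1 + r l =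
      r.\<close>
    define r where "r = 1 / (1 - l)"
    have "r * (1 - l) = 1" using l_less_1 by (simp add: r_def)
    then have "x + r * (r * x) * (l * (1 - l)) = r * x" for x by algebra
    then show ?thesis by (simp add: width_def flip: r_def)
  qed
  finally show ?case .
qed

text \<open>The right-hand side is the transfer operator applied to \<open>dens\<close>, branch by
  branch. Comparing it with \<open>dens_eq_suminf_cell\<close> turns the change of variables into
  invariance.\<close>

lemma dens_eq_suminf_width:
  "dens x = (\<Sum>k. ennreal ((1 / (1 - l)) ^ k) * (ennreal (width k) * indicator {0<..l ^ (k - 1)} x))"
proof (cases "0 < x \<and> x \<le> 1")
  case True
  then have *: "x \<in> {0<..l ^ (k - 1)} \<longleftrightarrow> k \<le> Suc (level x)" for k
    using level_ge_iff[of x "k - 1"] by auto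
  have nn: "0 \<le> (1 / (1 - l)) ^ k * width k" for k
    using l_less_1 width_pos[of k] by simp
  have "(\<Sum>k. ennreal ((1 / (1 - l)) ^ k) * (ennreal (width k) * indicator {0<..l ^ (k - 1)} x))
    = (\<Sum>k\<le>Suc (level x). ennreal ((1 / (1 - l)) ^ k) * (ennreal (width k) * indicator {0<..l ^ (k - 1)} x))"
    by (rule suminf_finite) (use * in auto)
  also have "\<dots> = (\<Sum>k\<le>Suc (level x). ennreal ((1 / (1 - l)) ^ k * width k))"
  proof (rule sum.cong)
    fix k assume "k \<in> {..Suc (level x)}"
    then have "x \<in> {0<..l ^ (k - 1)}" using * by simp
    then show "ennreal ((1 / (1 - l)) ^ k) * (ennreal (width k) * indicator {0<..l ^ (k - 1)} x) =
      ennreal ((1 / (1 - l)) ^ k * width k)"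
      using width_pos[of k] l_less_1 by (simp add: ennreal_mult del: greaterThanAtMost_iff)
  qed simp
  also have "\<dots> = ennreal (\<Sum>k\<le>Suc (level x). (1 / (1 - l)) ^ k * width k)"
    using nn by (intro sum_ennreal)
  finally show ?thesis using True sum_width by (simp add: dens_def del: sum.atMost_Suc)
next
  case False
  then have "x \<notin> {0<..l ^ (k - 1)}" for k using power_le_1[of "k - 1"] by auto
  with False show ?thesis by (auto simp: dens_def)
qed

lemma nn_integral_dens_T:
  assumes [measurable]: "\<psi> \<in> borel_measurable borel"
  shows "(\<integral>\<^sup>+x. \<psi> (T x) * dens x \<partial>lborel) = (\<integral>\<^sup>+x. \<psi> x * dens x \<partial>lborel)"
proof -
  let ?r = "\<lambda>k. ennreal ((1 / (1 - l)) ^ k)"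
  have "(\<integral>\<^sup>+x. \<psi> (T x) * dens x \<partial>lborel)
      = (\<integral>\<^sup>+x. (\<Sum>k. ?r k * (\<psi> (T x) * indicator (cell k) x)) \<partial>lborel)"
    by (subst dens_eq_suminf_cell) (simp flip: ennreal_suminf_cmult add: mult_ac)
  also have "\<dots> = (\<Sum>k. \<integral>\<^sup>+x. ?r k * (\<psi> (T x) * indicator (cell k) x) \<partial>lborel)"
    by (rule nn_integral_suminf) measurable
  also have "\<dots> = (\<Sum>k. ?r k * (\<integral>\<^sup>+x. \<psi> (T x) * indicator (cell k) x \<partial>lborel))"
    by (subst nn_integral_cmult) auto
  also have "\<dots> = (\<Sum>k. \<integral>\<^sup>+x. ?r k * (ennreal (width k) * (\<psi> x * indicator {0<..l ^ (k - 1)} x)) \<partial>lborel)"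
    by (simp add: nn_integral_cell nn_integral_cmult)
  also have "\<dots> = (\<integral>\<^sup>+x. (\<Sum>k. ?r k * (ennreal (width k) * (\<psi> x * indicator {0<..l ^ (k - 1)} x))) \<partial>lborel)"
    by (rule nn_integral_suminf[symmetric]) measurable
  also have "\<dots> = (\<integral>\<^sup>+x. \<psi> x * dens x \<partial>lborel)"
    by (subst dens_eq_suminf_width) (simp flip: ennreal_suminf_cmult add: mult_ac)
  finally show ?thesis .
qed

section \<open>Unfolding the invariance along excursions\<close>

text \<open>
The part of the Koopman operator that lives off cell 0; its m-th power at a point x of cell 0
evaluates the function at time m provided that the excursion of x still lasts.
\<close>

definition away :: "(real \<Rightarrow> ennreal) \<Rightarrow> real \<Rightarrow> ennreal" where
  "away \<phi> x = \<phi> (T x) * indicator (- cell 0) (T x)"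

lemma measurable_away [measurable]:
  assumes [measurable]: "\<phi> \<in> borel_measurable borel"
  shows "away \<phi> \<in> borel_measurable borel"
  unfolding away_def[abs_def] by measurable

lemma measurable_away_funpow [measurable]:
  "\<phi> \<in> borel_measurable borel \<Longrightarrow> (away ^^ m) \<phi> \<in> borel_measurable borel"
  by (induction m) auto

lemma away_funpow:
  "(away ^^ m) \<phi> x = \<phi> ((T ^^ m) x) * indicator {x. \<forall>i\<in>{1..m}. (T ^^ i) x \<notin> cell 0} x"
proof (induction m arbitrary: x)
  case (Suc m)
  have "{1..Suc m} = insert 1 (Suc ` {1..m})"
    by (auto simp: image_Suc_atLeastAtMost)
  then have *: "(\<forall>i\<in>{1..Suc m}. P i) \<longleftrightarrow> P 1 \<and> (\<forall>i\<in>{1..m}. P (Suc i))" for P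
    by (simp del: image_Suc_atLeastAtMost)
  have "(away ^^ Suc m) \<phi> x = (away ^^ m) \<phi> (T x) * indicator (- cell 0) (T x)"
    by (simp add: away_def)
  also have "\<dots> = \<phi> ((T ^^ Suc m) x) * indicator {x. \<forall>i\<in>{1..Suc m}. (T ^^ i) x \<notin> cell 0} x"
    unfolding Suc indicator_def mem_Collect_eq * by (simp add: funpow_swap1)
  finally show ?case .
qed simp

text \<open>One half of Kac's formula. Since \<open>dens\<close> is 1 on cell 0, the integral splits
  into a Lebesgue integral over cell 0 and a remainder off cell 0; invariance rewrites the remainder
  as the integral of \<open>away\<close> of the function. After M rounds the remainder is
  nonnegative and is dropped.\<close>

lemma nn_integral_excursion:
  assumes [measurable]: "\<phi> \<in> borel_measurable borel"
  shows "(\<Sum>m. \<integral>\<^sup>+x. (away ^^ m) \<phi> x * indicator (cell 0) x \<partial>lborel) \<le> (\<integral>\<^sup>+x. \<phi> x * dens x \<partial>lborel)"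
proof (rule suminf_le_const)
  have step: "(\<integral>\<^sup>+x. \<psi> x * dens x \<partial>lborel) =
      (\<integral>\<^sup>+x. \<psi> x * indicator (cell 0) x \<partial>lborel) + (\<integral>\<^sup>+x. away \<psi> x * dens x \<partial>lborel)"
    if [measurable]: "\<psi> \<in> borel_measurable borel" for \<psi>
  proof -
    have "(\<integral>\<^sup>+x. \<psi> x * dens x \<partial>lborel) =
      (\<integral>\<^sup>+x. \<psi> x * indicator (cell 0) x + (\<psi> x * indicator (- cell 0) x) * dens x \<partial>lborel)"
      using dens_cell[of _ 0] by (intro nn_integral_cong) (auto simp: indicator_def)
    also have "\<dots> = (\<integral>\<^sup>+x. \<psi> x * indicator (cell 0) x \<partial>lborel)
        + (\<integral>\<^sup>+x. (\<psi> x * indicator (- cell 0) x) * dens x \<partial>lborel)"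
      by (rule nn_integral_add) auto
    also have "(\<integral>\<^sup>+x. (\<psi> x * indicator (- cell 0) x) * dens x \<partial>lborel) = (\<integral>\<^sup>+x. away \<psi> x * dens x \<partial>lborel)"
      by (subst nn_integral_dens_T[symmetric]) (auto simp: away_def)
    finally show ?thesis .
  qed
  have unfold: "(\<integral>\<^sup>+x. \<phi> x * dens x \<partial>lborel) =
    (\<Sum>m<M. \<integral>\<^sup>+x. (away ^^ m) \<phi> x * indicator (cell 0) x \<partial>lborel) + (\<integral>\<^sup>+x. (away ^^ M) \<phi> x * dens x \<partial>lborel)" for M
  proof (induction M)
    case (Suc M)
    then show ?case
      using step[of "(away ^^ M) \<phi>"] by (simp add: add.assoc)
  qed simp
  show "(\<Sum>m<M. \<integral>\<^sup>+x. (away ^^ m) \<phi> x * indicator (cell 0) x \<partial>lborel) \<le> (\<integral>\<^sup>+x. \<phi> x * dens x \<partial>lborel)" for M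
    unfolding unfold[of M] by (rule add_increasing2) auto
qed simp

end

section \<open>Excursions\<close>

context folded_map
begin

text \<open>The q of the overview. Its inverse is the root other than 1 of t = l t^2 + (1 - l), the
  equation saying that t^k is harmonic for the walk on the levels.\<close>

definition ratio :: real where
  "ratio = l / (1 - l)"

lemma ratio_pos: "0 < ratio" and ratio_less_1: "ratio < 1"
  using l_pos l_less_half by (auto simp: ratio_def field_simps)

section \<open>Return time, accumulated cost and return map\<close>

text \<open>
The folded counterparts of \<^const>\<open>rho\<close>, \<^const>\<open>tau\<close> and \<^const>\<open>return_map\<close>.
\<close>

definition returns :: "real \<Rightarrow> bool" where
  "returns x \<longleftrightarrow> (\<exists>n\<ge>1. (T ^^ n) x \<in> cell 0)"

definition ret_time :: "real \<Rightarrow> nat" where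
  "ret_time x = (if returns x then LEAST n. n \<ge> 1 \<and> (T ^^ n) x \<in> cell 0 else 0)"

definition total :: "real \<Rightarrow> nat" where
  "total x = (\<Sum>j<ret_time x. cost ((T ^^ j) x))"

definition ret :: "real \<Rightarrow> real" where
  "ret x = (T ^^ ret_time x) x"

lemma ret_time_pos: "returns x \<Longrightarrow> 1 \<le> ret_time x"
  and ret_in_cell: "returns x \<Longrightarrow> ret x \<in> cell 0"
  using LeastI_ex[of "\<lambda>n. n \<ge> 1 \<and> (T ^^ n) x \<in> cell 0"]
  by (auto simp: ret_time_def ret_def returns_def)

lemma before_ret_time: "1 \<le> i \<Longrightarrow> i < ret_time x \<Longrightarrow> (T ^^ i) x \<notin> cell 0"
  using not_less_Least[of i "\<lambda>n. n \<ge> 1 \<and> (T ^^ n) x \<in> cell 0"]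
  by (auto simp: ret_time_def split: if_splits)

lemma ret_time_eqI:
  assumes "1 \<le> m" "(T ^^ m) x \<in> cell 0" "\<And>i. 1 \<le> i \<Longrightarrow> i < m \<Longrightarrow> (T ^^ i) x \<notin> cell 0"
  shows "returns x" "ret_time x = m"
proof -
  show "returns x" using assms by (auto simp: returns_def)
  then show "ret_time x = m"
    using assms by (auto simp: ret_time_def intro!: Least_equality) (metis not_le)
qed

text \<open>A point that never returns has return time 0, hence an empty cost sum.\<close>

lemma returns_if_total: "n < total x \<Longrightarrow> returns x"
  by (auto simp: total_def ret_time_def split: if_splits)

lemma measurable_returns [measurable]: "Measurable.pred borel returns"
  unfolding returns_def[abs_def] by measurable

lemma measurable_ret_time [measurable]: "ret_time \<in> borel \<rightarrow>\<^sub>M count_space UNIV"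
  unfolding ret_time_def[abs_def] by measurable

lemma measurable_total [measurable]: "total \<in> borel \<rightarrow>\<^sub>M count_space UNIV"
  unfolding total_def[abs_def]
  by (rule measurable_compose_countable[OF _ measurable_ret_time]) measurable

lemma measurable_ret [measurable]: "ret \<in> borel_measurable borel"
  unfolding ret_def[abs_def]
  by (rule measurable_compose_countable[OF _ measurable_ret_time]) measurable

text \<open>Cell k has length l^k (1 - l) and density (1 - l)^(-k), hence mass (1 - l) q^k with q =
  \<open>ratio\<close>.\<close>

lemma nn_integral_dens_level:
  assumes [measurable]: "\<phi> \<in> borel_measurable borel" and \<phi>: "\<And>k x. x \<in> cell k \<Longrightarrow> \<phi> x = c k"
  shows "(\<integral>\<^sup>+x. \<phi> x * dens x \<partial>lborel) = (\<Sum>k. c k * ennreal ((1 - l) * ratio ^ k))"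
proof -
  let ?r = "\<lambda>k. ennreal ((1 / (1 - l)) ^ k)"
  have "(\<integral>\<^sup>+x. \<phi> x * dens x \<partial>lborel)
      = (\<integral>\<^sup>+x. (\<Sum>k. ?r k * (\<phi> x * indicator (cell k) x)) \<partial>lborel)"
    by (subst dens_eq_suminf_cell) (simp flip: ennreal_suminf_cmult add: mult_ac)
  also have "\<dots> = (\<integral>\<^sup>+x. (\<Sum>k. ?r k * (c k * indicator (cell k) x)) \<partial>lborel)"
    using \<phi> by (intro nn_integral_cong suminf_cong) (auto simp: indicator_def)
  also have "\<dots> = (\<Sum>k. \<integral>\<^sup>+x. ?r k * (c k * indicator (cell k) x) \<partial>lborel)"
    by (rule nn_integral_suminf) measurable
  also have "\<dots> = (\<Sum>k. \<integral>\<^sup>+x. (c k * ?r k) * indicator (cell k) x \<partial>lborel)"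
    by (simp add: mult_ac)
  also have "\<dots> = (\<Sum>k. c k * (?r k * emeasure lborel (cell k)))"
    by (subst nn_integral_cmult_indicator) (simp_all add: mult.assoc)
  also have "\<dots> = (\<Sum>k. c k * ennreal ((1 - l) * ratio ^ k))"
  proof (intro suminf_cong arg_cong[where f = "(*) _"])
    fix k
    have "?r k * emeasure lborel (cell k) = ennreal ((1 / (1 - l)) ^ k * (l ^ k - l ^ Suc k))"
      unfolding emeasure_cell using l_less_1 by (subst ennreal_mult') auto
    also have "(1 / (1 - l)) ^ k * (l ^ k - l ^ Suc k) = (1 - l) * ratio ^ k"
      using l_less_1 by (simp add: ratio_def field_simps)
    finally show "?r k * emeasure lborel (cell k) = ennreal ((1 - l) * ratio ^ k)" .
  qed
  finally show ?thesis .
qed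

lemma nn_integral_dens_finite: "(\<integral>\<^sup>+x. dens x \<partial>lborel) < \<infinity>"
proof -
  have "(\<integral>\<^sup>+x. 1 * dens x \<partial>lborel) = (\<Sum>k. 1 * ennreal ((1 - l) * ratio ^ k))"
    by (rule nn_integral_dens_level) auto
  also have "\<dots> = ennreal (\<Sum>k. (1 - l) * ratio ^ k)"
    using ratio_pos ratio_less_1 l_less_1
    by (simp add: suminf_ennreal2 summable_mult summable_geometric)
  finally show ?thesis by simp
qed

section \<open>Almost sure return to cell 0\<close>

definition unreturned :: "nat \<Rightarrow> real set" where
  "unreturned m = {x \<in> cell 0. \<forall>i\<in>{1..m}. (T ^^ i) x \<notin> cell 0}"

lemma unreturned_sets [measurable]: "unreturned m \<in> sets borel"
  unfolding unreturned_def by measurable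

lemma fmeasurable_subset_cell:
  assumes "A \<subseteq> cell k" "A \<in> sets borel"
  shows "A \<in> fmeasurable lborel"
  using assms emeasure_mono[of A "cell k" lborel] emeasure_cell[of k]
  by (intro fmeasurableI) (auto simp: less_top[symmetric] top_unique)

text \<open>For the constant function 1 the excursion bound says that the measures of these sets
  have a sum of at most the total mass of \<open>dens\<close>, which is finite.\<close>

lemma measure_unreturned_LIMSEQ: "(\<lambda>m. measure lborel (unreturned m)) \<longlonglongrightarrow> 0"
proof -
  have fin: "unreturned m \<in> fmeasurable lborel" for m
    by (rule fmeasurable_subset_cell[of _ 0]) (auto simp: unreturned_def)
  have "ennreal (measure lborel (unreturned m)) =
      (\<integral>\<^sup>+x. (away ^^ m) (\<lambda>_. 1) x * indicator (cell 0) x \<partial>lborel)" for m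
  proof -
    have "(\<integral>\<^sup>+x. (away ^^ m) (\<lambda>_. 1) x * indicator (cell 0) x \<partial>lborel) =
        (\<integral>\<^sup>+x. indicator (unreturned m) x \<partial>lborel)"
      by (intro nn_integral_cong) (auto simp: away_funpow unreturned_def indicator_def)
    then show ?thesis using fin by (simp add: emeasure_eq_measure2)
  qed
  then have "(\<Sum>m. ennreal (measure lborel (unreturned m))) < \<infinity>"
    using nn_integral_excursion[of "\<lambda>_. 1"] nn_integral_dens_finite by simp
  then have "summable (\<lambda>m. measure lborel (unreturned m))"
    by (intro summable_suminf_not_top) auto
  then show ?thesis by (rule summable_LIMSEQ_zero)
qed

lemma AE_returns: "AE x in lborel. x \<in> cell 0 \<longrightarrow> returns x"
proof (rule AE_I)
  let ?N = "{x \<in> cell 0. \<not> returns x}"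
  show "{x \<in> space lborel. \<not> (x \<in> cell 0 \<longrightarrow> returns x)} \<subseteq> ?N" by auto
  show "?N \<in> sets lborel" by measurable
  have fin: "?N \<in> fmeasurable lborel"
    by (rule fmeasurable_subset_cell[of _ 0]) auto
  have "measure lborel ?N \<le> measure lborel (unreturned m)" for m
    by (intro measure_mono_fmeasurable fmeasurable_subset_cell[of _ 0])
       (auto simp: unreturned_def returns_def)
  then have "measure lborel ?N \<le> 0"
    using LIMSEQ_le_const[OF measure_unreturned_LIMSEQ] by blast
  then show "emeasure lborel ?N = 0"
    using fin by (simp add: emeasure_eq_measure2 ennreal_eq_0_iff)
qed

section \<open>Upper tail bound by truncation\<close>

definition tail :: "nat \<Rightarrow> real set" where
  "tail n = {x \<in> cell 0. n < total x}"

lemma tail_sets [measurable]: "tail n \<in> sets borel"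
  unfolding tail_def by measurable

lemma tail_fmeasurable: "tail n \<in> fmeasurable lborel"
  by (rule fmeasurable_subset_cell[of _ 0]) (auto simp: tail_def)

text \<open>Markov's inequality for a truncated cost: an excursion costing more than n either
  reaches level K or collects more than n from levels below K. The level K is free here and is
  matched to n in \<open>measure_tail_bounds\<close>.\<close>

lemma measure_tail_le:
  assumes "1 \<le> n"
  shows "measure lborel (tail n) \<le>
    (1 - l) * ((\<Sum>k<K. S k * ratio ^ k) / n + ratio ^ K / (1 - ratio))"
proof -
  \<comment> \<open>Reaching level K alone already contributes 1; below K the cost is measured in
    units of n.\<close>
  define c where "c k = (if K \<le> k then 1 else S k / n)" for k
  define \<phi> where "\<phi> x = (if 0 < x \<and> x \<le> 1 then ennreal (c (level x)) else 0)" for x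
  have [measurable]: "\<phi> \<in> borel_measurable borel"
  proof -
    have [measurable]: "(\<lambda>x. c (level x)) \<in> borel_measurable borel"
      by (auto intro: measurable_compose[OF measurable_level])
    show ?thesis unfolding \<phi>_def[abs_def] by measurable
  qed
  have c_nonneg: "0 \<le> c k" for k by (simp add: c_def)
  have ge1: "1 \<le> (\<Sum>m. (away ^^ m) \<phi> x)" if x: "x \<in> tail n" for x
  proof -
    have n: "n < (\<Sum>j<ret_time x. cost ((T ^^ j) x))" using x by (simp add: tail_def total_def)
    have eq: "(away ^^ m) \<phi> x = \<phi> ((T ^^ m) x)" if "m < ret_time x" for m
      using that before_ret_time[of _ x] by (auto simp: away_funpow)
    have "1 \<le> (\<Sum>m<ret_time x. \<phi> ((T ^^ m) x))"
    proof (cases "\<exists>j<ret_time x. \<phi> ((T ^^ j) x) \<ge> 1")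
      case True
      then obtain j where j: "j < ret_time x" "\<phi> ((T ^^ j) x) \<ge> 1" by blast
      have "\<phi> ((T ^^ j) x) \<le> (\<Sum>m<ret_time x. \<phi> ((T ^^ m) x))"
        by (rule member_le_sum) (use j in auto)
      with j(2) show ?thesis by (rule order.trans)
    next
      case False
      \<comment> \<open>Here no visited point has level K or more, so the summand is the rescaled
        cost itself; points outside (0, 1] cost nothing.\<close>
      have "ennreal (cost ((T ^^ j) x) / n) \<le> \<phi> ((T ^^ j) x)" if "j < ret_time x" for j
        using False that by (auto simp: \<phi>_def cost_def c_def split: if_splits)
      then have le: "(\<Sum>j<ret_time x. ennreal (cost ((T ^^ j) x) / n)) \<le> (\<Sum>m<ret_time x. \<phi> ((T ^^ m) x))"
        by (intro sum_mono) auto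
      have "1 \<le> ennreal (real (\<Sum>j<ret_time x. cost ((T ^^ j) x)) / n)"
        using n assms by (simp add: field_simps del: of_nat_sum)
      also have "\<dots> = (\<Sum>j<ret_time x. ennreal (cost ((T ^^ j) x) / n))"
        by (simp add: sum_divide_distrib)
      finally show ?thesis using le by (rule order.trans)
    qed
    also have "\<dots> = (\<Sum>m<ret_time x. (away ^^ m) \<phi> x)"
      using eq by simp
    also have "\<dots> \<le> (\<Sum>m. (away ^^ m) \<phi> x)"
      by (rule sum_le_suminf) auto
    finally show ?thesis .
  qed
  have sm: "summable (\<lambda>k. ratio ^ k)" using ratio_pos ratio_less_1 by (simp add: summable_geometric)
  have smc: "summable (\<lambda>k. c k * ((1 - l) * ratio ^ k))"
  proof -
    have "summable (\<lambda>k. c (k + K) * ((1 - l) * ratio ^ (k + K)))"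
      using sm by (simp add: c_def summable_mult summable_mult2 power_add)
    then show ?thesis by (subst (asm) summable_iff_shift)
  qed
  have nn: "0 \<le> c k * ((1 - l) * ratio ^ k)" for k
    using c_nonneg[of k] ratio_pos l_less_1 by simp
  have "ennreal (measure lborel (tail n)) = (\<integral>\<^sup>+x. indicator (tail n) x \<partial>lborel)"
    using tail_fmeasurable by (simp add: emeasure_eq_measure2)
  also have "\<dots> \<le> (\<integral>\<^sup>+x. (\<Sum>m. (away ^^ m) \<phi> x * indicator (cell 0) x) \<partial>lborel)"
    using ge1 by (intro nn_integral_mono) (auto simp: indicator_def tail_def)
  also have "\<dots> = (\<Sum>m. \<integral>\<^sup>+x. (away ^^ m) \<phi> x * indicator (cell 0) x \<partial>lborel)"
    by (rule nn_integral_suminf) measurable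
  also have "\<dots> \<le> (\<integral>\<^sup>+x. \<phi> x * dens x \<partial>lborel)"
    by (rule nn_integral_excursion) measurable
  also have "\<dots> = (\<Sum>k. ennreal (c k) * ennreal ((1 - l) * ratio ^ k))"
    by (rule nn_integral_dens_level) (auto simp: \<phi>_def in_cell_iff)
  also have "\<dots> = ennreal (\<Sum>k. c k * ((1 - l) * ratio ^ k))"
    using smc nn c_nonneg ratio_pos l_less_1
    by (simp add: suminf_ennreal2 flip: ennreal_mult)
  finally have "measure lborel (tail n) \<le> (\<Sum>k. c k * ((1 - l) * ratio ^ k))"
    using nn by (simp add: suminf_nonneg smc)
  also have "\<dots> = (\<Sum>k. c (k + K) * ((1 - l) * ratio ^ (k + K))) + (\<Sum>k<K. c k * ((1 - l) * ratio ^ k))"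
    by (rule suminf_split_initial_segment[OF smc])
  also have "(\<Sum>k. c (k + K) * ((1 - l) * ratio ^ (k + K))) = (\<Sum>k. (1 - l) * ratio ^ K * ratio ^ k)"
    by (simp add: c_def power_add mult_ac)
  also have "\<dots> = (1 - l) * (ratio ^ K / (1 - ratio))"
    using ratio_pos ratio_less_1 by (subst suminf_mult[OF sm]) (simp add: suminf_geometric)
  also have "(\<Sum>k<K. c k * ((1 - l) * ratio ^ k)) = (1 - l) * ((\<Sum>k<K. S k * ratio ^ k) / n)"
    unfolding sum_divide_distrib sum_distrib_left by (intro sum.cong) (auto simp: c_def)
  finally show ?thesis by (simp add: algebra_simps)
qed

section \<open>Lower tail bound by gambler's ruin\<close>

text \<open>
The function (1/q)^k is harmonic for the walk on the cells and the overshoot is memoryless; hence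
\<open>gain\<close> is subharmonic below K, vanishes at 0 and equals 1 from K on.
\<close>

definition gain :: "nat \<Rightarrow> nat \<Rightarrow> real" where
  "gain K k = (if K \<le> k then 1 else ((1 / ratio) ^ k - 1) * ratio ^ Suc K)"

text \<open>A stopped game with horizon m: it pays 1 on reaching (0, l^K], pays 0 on entering cell 0
  first, and pays \<open>gain\<close> of the current level if neither has happened after m steps
  (for K at least 1).\<close>

primrec payoff :: "nat \<Rightarrow> nat \<Rightarrow> real \<Rightarrow> ennreal" where
  "payoff K 0 x = ennreal (gain K (level x)) * indicator {0<..1} x"
| "payoff K (Suc m) x = indicator {0<..l ^ K} x + payoff K m (T x) * indicator {l ^ K<..l} x"

lemma measurable_payoff [measurable]: "payoff K m \<in> borel_measurable borel"
proof (induction m)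
  case 0
  have [measurable]: "(\<lambda>x. gain K (level x)) \<in> borel_measurable borel"
    by (auto intro: measurable_compose[OF measurable_level])
  show ?case unfolding payoff.simps(1)[abs_def] by measurable
next
  case (Suc m)
  note Suc [measurable]
  show ?case unfolding payoff.simps(2)[abs_def] by measurable
qed

text \<open>Optional stopping by induction on the horizon. Divided by l^k, the left side is the
  harmonic formula at level k + 1, and (0, l^k] is, up to endpoints, the image of cell k + 1; so the
  bound at horizon m yields the bound on cell k + 1 at horizon m + 1.\<close>

lemma nn_integral_payoff_ge:
  assumes "1 \<le> K" "k \<le> K"
  shows "ennreal (((1 / ratio) ^ Suc k - 1) * ratio ^ Suc K * l ^ k)
    \<le> (\<integral>\<^sup>+x. payoff K m x * indicator {0<..l ^ k} x \<partial>lborel)"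
  using assms(2)
proof (induction m arbitrary: k)
  have r: "ratio \<noteq> 0" "ratio \<ge> 0" "1 / ratio \<ge> 1" using ratio_pos ratio_less_1 by auto
  let ?t = "1 / ratio"
  let ?J = "\<lambda>k. (?t ^ Suc k - 1) * ratio ^ Suc K * l ^ k"
  let ?g = "\<lambda>k. (?t ^ k - 1) * ratio ^ Suc K"
  have g_nonneg: "0 \<le> ?g k" for k
    using r by (auto intro!: mult_nonneg_nonneg one_le_power)
  \<comment> \<open>For a fixed horizon, bounds on single cells are summed downwards from k = K,
    using that (0, l^k] is the union of (0, l^(k+1)] and cell k. Each stage of the induction on m
    then only has to supply the cell bounds.\<close>
  have main: "ennreal (?J k) \<le> (\<integral>\<^sup>+x. payoff K m x * indicator {0<..l ^ k} x \<partial>lborel)"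
    if top: "\<And>x. x \<in> {0<..l ^ K} \<Longrightarrow> payoff K m x = 1"
      and cells: "\<And>k. k < K \<Longrightarrow> ennreal (?g k * (l ^ k - l ^ Suc k)) \<le>
        (\<integral>\<^sup>+x. payoff K m x * indicator (cell k) x \<partial>lborel)"
      and "k \<le> K" for k m
    using \<open>k \<le> K\<close>
  proof (induction k rule: inc_induct)
    case base
    have "?J K = (1 - ratio ^ Suc K) * l ^ K"
      using r by (simp add: field_simps power_divide)
    also have "\<dots> \<le> l ^ K"
      using r l_pos by (auto intro!: mult_left_le_one_le)
    finally have "ennreal (?J K) \<le> ennreal (l ^ K)" by (rule ennreal_leI)
    also have "\<dots> = (\<integral>\<^sup>+x. indicator {0<..l ^ K} x \<partial>lborel)"
      using l_pos by simp
    also have "\<dots> = (\<integral>\<^sup>+x. payoff K m x * indicator {0<..l ^ K} x \<partial>lborel)"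
      using top by (intro nn_integral_cong) (auto simp: indicator_def)
    finally show ?case .
  next
    case (step k)
    \<comment> \<open>The harmonic equation of the walk, whose steps are Geometric - 1.\<close>
    have id: "?t = l * ?t ^ 2 + (1 - l)"
      using l_pos l_less_half by (simp add: ratio_def field_simps power2_eq_square)
    have "?J k = ratio ^ Suc K * l ^ k * (?t ^ k * ?t - 1)"
      by simp
    also have "\<dots> = ratio ^ Suc K * l ^ k * (?t ^ k * (l * ?t ^ 2 + (1 - l)) - 1)"
      using id by simp
    also have "\<dots> = ?J (Suc k) + ?g k * (l ^ k - l ^ Suc k)"
      by (simp add: algebra_simps power2_eq_square)
    finally have "ennreal (?J k) = ennreal (?J (Suc k) + ?g k * (l ^ k - l ^ Suc k))" by (rule arg_cong)
    also have "\<dots> = ennreal (?J (Suc k)) + ennreal (?g k * (l ^ k - l ^ Suc k))"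
    proof (rule ennreal_plus)
      show "0 \<le> ?J (Suc k)"
        by (rule mult_nonneg_nonneg[OF g_nonneg]) (use l_pos in simp)
      show "0 \<le> ?g k * (l ^ k - l ^ Suc k)"
        by (rule mult_nonneg_nonneg[OF g_nonneg])
           (use power_le_power_iff[of "Suc k" k] in \<open>simp del: power_Suc\<close>)
    qed
    also have "\<dots> \<le> (\<integral>\<^sup>+x. payoff K m x * indicator {0<..l ^ Suc k} x \<partial>lborel)
        + (\<integral>\<^sup>+x. payoff K m x * indicator (cell k) x \<partial>lborel)"
      using step.IH cells[of k] step.hyps by (intro add_mono) auto
    also have "\<dots> = (\<integral>\<^sup>+x. payoff K m x * indicator {0<..l ^ Suc k} x + payoff K m x * indicator (cell k) x \<partial>lborel)"
      by (rule nn_integral_add[symmetric]) auto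
    also have "\<dots> = (\<integral>\<^sup>+x. payoff K m x * indicator {0<..l ^ k} x \<partial>lborel)"
      using power_le_power_iff[of "Suc k" k] l_pos zero_less_power[OF l_pos, of "Suc k"]
      by (intro nn_integral_cong) (auto simp: indicator_def cell_def simp del: power_Suc zero_less_power)
    finally show ?case .
  qed
  {
    case 0
    show ?case
    proof (rule main[OF _ _ 0])
      fix x assume "x \<in> {0<..l ^ K}"
      then show "payoff K 0 x = 1"
        using power_le_1[of K] level_ge_iff[of x K] by (auto simp: gain_def)
    next
      fix k assume "k < K"
      then have "(\<integral>\<^sup>+x. payoff K 0 x * indicator (cell k) x \<partial>lborel) =
          (\<integral>\<^sup>+x. ennreal (?g k) * indicator (cell k) x \<partial>lborel)"
        by (intro nn_integral_cong) (auto simp: gain_def in_cell_iff indicator_def)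
      then show "ennreal (?g k * (l ^ k - l ^ Suc k)) \<le>
          (\<integral>\<^sup>+x. payoff K 0 x * indicator (cell k) x \<partial>lborel)"
        using g_nonneg[of k] by (simp add: nn_integral_cmult emeasure_cell ennreal_mult')
    qed
  next
    case (Suc m)
    show ?case
    proof (rule main[OF _ _ Suc.prems])
      fix x assume "x \<in> {0<..l ^ K}"
      then show "payoff K (Suc m) x = 1" by simp
    next
      fix k assume k: "k < K"
      show "ennreal (?g k * (l ^ k - l ^ Suc k)) \<le>
          (\<integral>\<^sup>+x. payoff K (Suc m) x * indicator (cell k) x \<partial>lborel)"
      proof (cases k)
        \<comment> \<open>Cell k is spread uniformly over (0, l^j], so the hypothesis at j applies.
          For k = 0 the required bound is 0.\<close>
        case (Suc j)
        have "?g k * (l ^ k - l ^ Suc k) = ?g k * (width k * l ^ (k - 1))"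
          by (simp only: width_times_power)
        also have "\<dots> = width k * ?J j"
          by (simp add: Suc)
        finally have "ennreal (?g k * (l ^ k - l ^ Suc k)) = ennreal (width k * ?J j)"
          by (rule arg_cong)
        also have "\<dots> = ennreal (width k) * ennreal (?J j)"
          using width_pos[of k] by (intro ennreal_mult') simp
        also have "\<dots> \<le> ennreal (width k) * (\<integral>\<^sup>+x. payoff K m x * indicator {0<..l ^ j} x \<partial>lborel)"
          using Suc.IH[of j] k Suc by (intro mult_left_mono) auto
        also have "\<dots> = (\<integral>\<^sup>+x. payoff K m (T x) * indicator (cell k) x \<partial>lborel)"
          by (subst nn_integral_cell) (auto simp: Suc)
        also have "\<dots> = (\<integral>\<^sup>+x. payoff K (Suc m) x * indicator (cell k) x \<partial>lborel)"
        proof (intro nn_integral_cong)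
          fix x
          have "l ^ K \<le> l ^ Suc k" "l ^ k \<le> l"
            using k Suc power_le_power_iff[of K "Suc k"] power_le_power_iff[of k 1] by simp_all
          then show "payoff K m (T x) * indicator (cell k) x = payoff K (Suc m) x * indicator (cell k) x"
            by (auto simp: indicator_def cell_def simp del: power_Suc)
        qed
        finally show ?thesis .
      qed simp
    qed
  }
qed

text \<open>Time 0 counts, because the set is applied to T x for a starting point x of cell
  0.\<close>

definition climbs :: "nat \<Rightarrow> real set" where
  "climbs K = {y. \<exists>j. (T ^^ j) y \<in> {0<..l ^ K} \<and> (\<forall>i<j. (T ^^ i) y \<notin> cell 0)}"

lemma climbs_sets [measurable]: "climbs K \<in> sets borel"
  unfolding climbs_def by measurable

text \<open>A payoff never exceeds 1 and is nonzero only if the orbit has climbed to level K or has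
  avoided cell 0 for m steps.\<close>

lemma payoff_le:
  assumes "1 \<le> K"
  shows "payoff K m y \<le> indicator (climbs K) y + indicator {y. \<forall>i<m. (T ^^ i) y \<notin> cell 0} y"
proof (induction m arbitrary: y)
  case 0
  have "gain K k \<le> 1" for k
  proof (cases "K \<le> k")
    case False
    then have "ratio ^ Suc K = ratio ^ k * ratio ^ (Suc K - k)"
      by (simp flip: power_add)
    moreover have "((1 / ratio) ^ k - 1) * ratio ^ Suc K \<le> (1 / ratio) ^ k * ratio ^ Suc K"
      using ratio_pos by (intro mult_right_mono) auto
    ultimately have "((1 / ratio) ^ k - 1) * ratio ^ Suc K \<le> (1 / ratio) ^ k * ratio ^ k * ratio ^ (Suc K - k)"
      by (simp add: mult.assoc)
    also have "\<dots> = ratio ^ (Suc K - k)" using ratio_pos by (simp add: power_divide)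
    also have "\<dots> \<le> 1" using ratio_pos ratio_less_1 by (simp add: power_le_one)
    finally show ?thesis using False by (simp add: gain_def)
  qed (simp add: gain_def)
  then show ?case by (auto simp: indicator_def add_increasing)
next
  case (Suc m)
  consider "y \<in> {0<..l ^ K}" | "y \<in> {l ^ K<..l}" | "y \<notin> {0<..l ^ K}" "y \<notin> {l ^ K<..l}" by blast
  then show ?case
  proof cases
    case 1
    then have "y \<in> climbs K" by (auto simp: climbs_def intro!: exI[of _ 0])
    with 1 show ?thesis by auto
  next
    case 2
    have y: "y \<notin> cell 0" using 2 by (simp add: cell_def)
    have c: "y \<in> climbs K" if Ty: "T y \<in> climbs K"
    proof -
      obtain j where "(T ^^ j) (T y) \<in> {0<..l ^ K}" "\<forall>i<j. (T ^^ i) (T y) \<notin> cell 0"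
        using Ty unfolding climbs_def mem_Collect_eq by blast
      then have "(T ^^ Suc j) y \<in> {0<..l ^ K} \<and> (\<forall>i<Suc j. (T ^^ i) y \<notin> cell 0)"
        using y by (auto simp: All_less_Suc2 funpow_Suc_right simp del: funpow.simps)
      then show ?thesis unfolding climbs_def by blast
    qed
    have s: "(\<forall>i<m. (T ^^ i) (T y) \<notin> cell 0) \<Longrightarrow> (\<forall>i<Suc m. (T ^^ i) y \<notin> cell 0)"
      using y by (auto simp: All_less_Suc2 funpow_Suc_right simp del: funpow.simps)
    have "payoff K (Suc m) y = payoff K m (T y)" using 2 by simp
    also have "\<dots> \<le> indicator (climbs K) (T y) + indicator {y. \<forall>i<m. (T ^^ i) y \<notin> cell 0} (T y)"
      by (rule Suc)
    also have "\<dots> \<le> indicator (climbs K) y + indicator {y. \<forall>i<Suc m. (T ^^ i) y \<notin> cell 0} y"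
      using c s by (intro add_mono) (auto simp: indicator_def)
    finally show ?thesis .
  qed simp
qed

text \<open>The payoff bound at k = 0 is pulled back along the branch on cell 0. As the horizon
  grows, the undecided excursions have measure tending to 0, which leaves the excursions that reach
  level K.\<close>

lemma measure_tail_ge:
  assumes "1 \<le> K"
  shows "(1 - l) * (1 / ratio - 1) * ratio ^ Suc K \<le> measure lborel (tail (S K))"
proof -
  define H where "H = {x \<in> cell 0. T x \<in> climbs K}"
  have [measurable]: "H \<in> sets borel" unfolding H_def by measurable
  have H_fin: "H \<in> fmeasurable lborel"
    by (rule fmeasurable_subset_cell[of _ 0]) (auto simp: H_def)
  have U_fin: "unreturned m \<in> fmeasurable lborel" for m
    by (rule fmeasurable_subset_cell[of _ 0]) (auto simp: unreturned_def)
  have nn: "0 \<le> (1 / ratio - 1) * ratio ^ Suc K"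
    using ratio_pos ratio_less_1 by simp
  have bound: "(1 - l) * (1 / ratio - 1) * ratio ^ Suc K \<le> measure lborel H + measure lborel (unreturned m)" for m
  proof -
    have "ennreal ((1 - l) * (1 / ratio - 1) * ratio ^ Suc K)
        = ennreal (width 0) * ennreal ((1 / ratio - 1) * ratio ^ Suc K)"
      using l_less_1 by (simp add: width_def mult.assoc flip: ennreal_mult')
    also have "\<dots> \<le> ennreal (width 0) * (\<integral>\<^sup>+x. payoff K m x * indicator {0<..l ^ (0 - 1)} x \<partial>lborel)"
      using nn_integral_payoff_ge[of K 0 m] assms by (intro mult_left_mono) auto
    also have "\<dots> = (\<integral>\<^sup>+x. payoff K m (T x) * indicator (cell 0) x \<partial>lborel)"
      by (rule nn_integral_cell[symmetric]) measurable
    also have "\<dots> \<le> (\<integral>\<^sup>+x. indicator H x + indicator (unreturned m) x \<partial>lborel)"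
    proof (intro nn_integral_mono)
      fix x
      have *: "{1..m} = Suc ` {..<m}" by (auto simp: image_iff Suc_le_eq gr0_conv_Suc)
      have "indicator (unreturned m) x = (indicator (cell 0) x :: ennreal) *
          indicator {y. \<forall>i<m. (T ^^ i) y \<notin> cell 0} (T x)"
        unfolding unreturned_def *
        by (auto simp: indicator_def funpow_Suc_right simp del: funpow.simps)
      moreover have "indicator H x = (indicator (cell 0) x :: ennreal) * indicator (climbs K) (T x)"
        by (auto simp: H_def indicator_def)
      ultimately show "payoff K m (T x) * indicator (cell 0) x \<le> indicator H x + indicator (unreturned m) x"
        using payoff_le[OF assms, of m "T x"] by (auto simp: indicator_def)
    qed
    also have "\<dots> = ennreal (measure lborel H) + ennreal (measure lborel (unreturned m))"
      using H_fin U_fin by (simp add: nn_integral_add emeasure_eq_measure2)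
    finally show ?thesis
      by (simp flip: ennreal_plus)
  qed
  have "(\<lambda>m. measure lborel H + measure lborel (unreturned m)) \<longlonglongrightarrow> measure lborel H + 0"
    by (intro tendsto_intros measure_unreturned_LIMSEQ)
  then have "(1 - l) * (1 / ratio - 1) * ratio ^ Suc K \<le> measure lborel H"
    using bound by (intro LIMSEQ_le_const[of _ "measure lborel H"]) auto
  also have "measure lborel H \<le> measure lborel (tail (S K))"
  proof -
    have up: "x \<in> tail (S K)" if x: "x \<in> H" "returns x" for x
    proof -
      from x obtain j where j: "(T ^^ j) (T x) \<in> {0<..l ^ K}" "\<forall>i<j. (T ^^ i) (T x) \<notin> cell 0"
        by (auto simp: H_def climbs_def)
      have x0: "x \<in> cell 0" using x by (simp add: H_def)
      have "l ^ K \<le> l" using assms power_le_power_iff[of K 1] by simp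
      with j have Tj: "(T ^^ Suc j) x \<in> {0<..l ^ K}" "(T ^^ Suc j) x \<notin> cell 0"
        by (auto simp: cell_def funpow_swap1)
      have "Suc j < ret_time x"
      proof (rule ccontr)
        assume "\<not> Suc j < ret_time x"
        moreover have "ret_time x \<noteq> Suc j" using Tj(2) ret_in_cell[OF x(2)] by (auto simp: ret_def)
        ultimately obtain i where i: "ret_time x = Suc i" "i < j"
          using ret_time_pos[OF x(2)] by (cases "ret_time x") auto
        then show False using j(2) ret_in_cell[OF x(2)] by (auto simp: ret_def funpow_swap1)
      qed
      then have sub: "{0, Suc j} \<subseteq> {..<ret_time x}" by auto
      have "cost ((T ^^ 0) x) + cost ((T ^^ Suc j) x) = (\<Sum>i\<in>{0, Suc j}. cost ((T ^^ i) x))" by simp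
      also have "\<dots> \<le> total x" unfolding total_def by (rule sum_mono2) (use sub in auto)
      finally have *: "cost x + cost ((T ^^ Suc j) x) \<le> total x" by simp
      \<comment> \<open>The unit cost of the start in cell 0 makes the inequality against
        \<open>S K\<close> strict.\<close>
      have "cost x = 1" using x0 by (simp add: in_cell_iff cost_def S_def)
      moreover have "S K \<le> S (level ((T ^^ Suc j) x))"
        using Tj(1) power_le_1[of K] level_ge_iff[of "(T ^^ Suc j) x" K]
        unfolding S_def by (intro fib_mono) auto
      then have "S K \<le> cost ((T ^^ Suc j) x)"
        using Tj(1) power_le_1[of K] by (auto simp: cost_def simp del: funpow.simps)
      ultimately show ?thesis using * x0 by (simp add: tail_def)
    qed
    have "AE x in lborel. x \<in> H \<longrightarrow> x \<in> tail (S K)"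
      using AE_returns by eventually_elim (use up in \<open>auto simp: H_def\<close>)
    then have "emeasure lborel H \<le> emeasure lborel (tail (S K))"
      by (intro emeasure_mono_AE) auto
    then show ?thesis using H_fin tail_fmeasurable by (simp add: emeasure_eq_measure2)
  qed
  finally show ?thesis .
qed

end

section \<open>Renewal and uniqueness of the invariant measure\<close>

lemma distr_funpow:
  assumes R: "R \<in> measurable M M" and inv: "distr M M R = M"
  shows "distr M M (R ^^ i) = M"
proof (induction i)
  case 0
  then show ?case by (simp add: distr_id2 id_def)
next
  case (Suc i)
  have "distr M M (R ^^ Suc i) = distr (distr M M (R ^^ i)) M R"
    using R by (subst distr_distr) (auto intro: measurable_compose_n)
  with Suc inv show ?case by (simp only:)
qed

text \<open>The centred indicators of A along the orbit are uncorrelated under P, so their averages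
  tend to 0 in L2(P), and P-almost everywhere along a subsequence. That statement passes to N by
  absolute continuity, while under N every average has mean N(A) - P(A) by invariance.\<close>

lemma measure_eq_if_renewal:
  assumes P: "prob_space P" and N: "prob_space N" and sets: "sets N = sets P"
    and ac: "absolutely_continuous P N"
    and R: "R \<in> measurable P P" and invP: "distr P P R = P" and invN: "distr N N R = N"
    and A[measurable]: "A \<in> sets P"
    and renewal: "\<And>B. B \<in> sets P \<Longrightarrow>
      measure P (A \<inter> (R -` B \<inter> space P)) = measure P A * measure P B"
  shows "measure N A = measure P A"
proof -
  interpret P: prob_space P by fact
  interpret N: prob_space N by fact
  note [measurable_cong] = sets
  have R'[measurable]: "R ^^ i \<in> measurable P P" for i
    using R by (rule measurable_compose_n)
  have RN: "R \<in> measurable N N" using R by measurable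
  have spaceN: "space N = space P" using sets by (rule sets_eq_imp_space_eq)
  define p where "p = measure P A"
  define g :: "'a \<Rightarrow> real" where "g x = indicator A x - p" for x
  have [measurable]: "g \<in> borel_measurable P" unfolding g_def by measurable
  have p01: "0 \<le> p" "p \<le> 1" by (auto simp: p_def)
  have g_bound: "\<bar>g x\<bar> \<le> 1" for x using p01 by (auto simp: g_def indicator_def)
  have bdP: "integrable P f" if "f \<in> borel_measurable P" "\<And>x. \<bar>f x\<bar> \<le> C" for f :: "'a \<Rightarrow> real" and C
    using that by (intro P.integrable_const_bound[where B = C]) auto
  have shift: "(\<integral>x. f ((R ^^ i) x) \<partial>P) = (\<integral>x. f x \<partial>P)" if "f \<in> borel_measurable P" for f :: "'a \<Rightarrow> real" and i
  proof -
    have "(\<integral>x. f x \<partial>distr P P (R ^^ i)) = (\<integral>x. f ((R ^^ i) x) \<partial>P)"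
      using that by (intro integral_distr) auto
    then show ?thesis using distr_funpow[OF R invP] by simp
  qed
  have meas_pre: "measure P ((R ^^ i) -` B \<inter> space P) = measure P B" if "B \<in> sets P" for B i
    using measure_distr[OF R' that, of i] distr_funpow[OF R invP] by simp
  \<comment> \<open>Renewal is applied to the preimage of A under the k-th iterate; the four terms
    of the expanded product then cancel.\<close>
  have corr0: "(\<integral>x. g x * g ((R ^^ Suc k) x) \<partial>P) = 0" for k
  proof -
    define B where "B = (R ^^ k) -` A \<inter> space P"
    define D where "D = R -` B \<inter> space P"
    have [measurable]: "B \<in> sets P" "D \<in> sets P"
      unfolding B_def D_def using measurable_sets[OF R] by measurable
    have mB: "measure P B = p" unfolding B_def using meas_pre A by (simp add: p_def)
    have mD: "measure P D = p" unfolding D_def using meas_pre[of B 1] mB by simp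
    have mAD: "measure P (A \<inter> D) = p * p"
      using renewal[of B] mB by (simp add: D_def p_def)
    have "(\<integral>x. g x * g ((R ^^ Suc k) x) \<partial>P) =
        (\<integral>x. indicator (A \<inter> D) x - p * indicator A x - p * indicator D x + p * p \<partial>P)"
    proof (rule Bochner_Integration.integral_cong)
      fix x assume x: "x \<in> space P"
      then have "R x \<in> space P" using R by (rule measurable_space[rotated])
      with x have "(R ^^ Suc k) x \<in> A \<longleftrightarrow> x \<in> D" by (simp add: D_def B_def funpow_swap1)
      then have "g ((R ^^ Suc k) x) = indicator D x - p" by (simp add: g_def indicator_def)
      then show "g x * g ((R ^^ Suc k) x) = indicator (A \<inter> D) x - p * indicator A x - p * indicator D x + p * p"
        by (simp add: g_def algebra_simps indicator_inter_arith)
    qed simp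
    also have "\<dots> = measure P (A \<inter> D) - p * measure P A - p * measure P D + p * p"
      by (simp add: P.emeasure_eq_measure P.prob_space)
    finally show ?thesis by (simp add: mAD mD p_def)
  qed
  have corr: "(\<integral>x. g ((R ^^ i) x) * g ((R ^^ j) x) \<partial>P) = 0" if ij: "i < j" for i j
  proof -
    obtain k where j: "j = Suc k + i" using less_imp_Suc_add[OF ij] by (auto simp: add.commute)
    have "(\<integral>x. g ((R ^^ i) x) * g ((R ^^ Suc k) ((R ^^ i) x)) \<partial>P) = (\<integral>x. g x * g ((R ^^ Suc k) x) \<partial>P)"
      by (rule shift[of "\<lambda>x. g x * g ((R ^^ Suc k) x)"]) measurable
    then show ?thesis unfolding j funpow_add by (simp only: corr0 o_def)
  qed
  have corr': "(\<integral>x. g ((R ^^ i) x) * g ((R ^^ j) x) \<partial>P) \<le> (if i = j then 1 else 0)" for i j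
  proof (cases i j rule: linorder_cases)
    case equal
    have "g x * g x \<le> 1" for x using g_bound[of x] by (simp add: abs_le_square_iff[of _ 1, simplified] power2_eq_square)
    then have "(\<integral>x. g ((R ^^ i) x) * g ((R ^^ i) x) \<partial>P) \<le> (\<integral>x. 1 \<partial>P)"
      by (intro integral_mono bdP[of _ 1]) (auto simp: abs_mult g_bound mult_le_one)
    with equal show ?thesis by (simp add: P.prob_space)
  qed (use corr[of i j] corr[of j i] in \<open>auto simp: mult.commute\<close>)
  have int_gg: "integrable P (\<lambda>x. g ((R ^^ i) x) * g ((R ^^ j) x))" for i j
    by (intro bdP[of _ 1]) (auto simp: abs_mult g_bound mult_le_one)
  define av where "av n x = (\<Sum>i<Suc n. g ((R ^^ i) x)) / Suc n" for n x
  have [measurable]: "av n \<in> borel_measurable P" for n unfolding av_def by measurable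
  have av_bound: "\<bar>av n x\<bar> \<le> 1" for n x
  proof -
    have "\<bar>\<Sum>i<Suc n. g ((R ^^ i) x)\<bar> \<le> (\<Sum>i<Suc n. 1)"
      by (rule order.trans[OF sum_abs]) (intro sum_mono g_bound)
    then show ?thesis by (simp add: av_def abs_divide divide_le_eq del: sum.lessThan_Suc)
  qed
  \<comment> \<open>Only the n + 1 diagonal terms survive, each at most 1, against the squared
    denominator.\<close>
  have av2: "(\<integral>x. (av n x)\<^sup>2 \<partial>P) \<le> 1 / Suc n" for n
  proof -
    have "(\<integral>x. (\<Sum>i<Suc n. g ((R ^^ i) x))\<^sup>2 \<partial>P) =
      (\<Sum>i<Suc n. \<Sum>j<Suc n. \<integral>x. g ((R ^^ i) x) * g ((R ^^ j) x) \<partial>P)"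
      unfolding power2_eq_square sum_product using int_gg
      by (subst Bochner_Integration.integral_sum, fastforce)+ simp
    also have "\<dots> \<le> (\<Sum>i<Suc n. \<Sum>j<Suc n. if i = j then 1 else 0)"
      by (intro sum_mono corr')
    also have "\<dots> = real (Suc n)" by (simp del: sum.lessThan_Suc)
    finally have "(\<integral>x. (\<Sum>i<Suc n. g ((R ^^ i) x))\<^sup>2 \<partial>P) / (real (Suc n))\<^sup>2 \<le> real (Suc n) / (real (Suc n))\<^sup>2"
      by (rule divide_right_mono) simp
    also have "real (Suc n) / (real (Suc n))\<^sup>2 = 1 / real (Suc n)"
      by (simp add: power2_eq_square)
    finally show ?thesis
      by (simp add: av_def power_divide del: sum.lessThan_Suc of_nat_Suc)
  qed
  have "(\<lambda>n. \<integral>x. norm ((av n x)\<^sup>2) \<partial>P) \<longlonglongrightarrow> 0"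
  proof (rule tendsto_sandwich[where f = "\<lambda>_. 0" and h = "\<lambda>n. 1 / real (Suc n)"])
    show "(\<lambda>n. 1 / real (Suc n)) \<longlonglongrightarrow> 0"
      using LIMSEQ_inverse_real_of_nat by (simp add: inverse_eq_divide)
    show "\<forall>\<^sub>F n in sequentially. (\<integral>x. norm ((av n x)\<^sup>2) \<partial>P) \<le> 1 / real (Suc n)"
      using av2 by simp
  qed (auto intro!: always_eventually)
  moreover have "integrable P (\<lambda>x. (av n x)\<^sup>2)" for n
    by (rule bdP[of _ 1]) (use av_bound in \<open>auto simp: abs_square_le_1\<close>)
  ultimately obtain r where "AE x in P. (\<lambda>n. (av (r n) x)\<^sup>2) \<longlonglongrightarrow> 0"
    using tendsto_L1_AE_subseq[of P "\<lambda>n x. (av n x)\<^sup>2"] by blast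
  then have "AE x in N. (\<lambda>n. (av (r n) x)\<^sup>2) \<longlonglongrightarrow> 0"
    by (rule absolutely_continuous_AE[OF sets ac])
  then have "AE x in N. (\<lambda>n. av (r n) x) \<longlonglongrightarrow> 0"
  proof eventually_elim
    case (elim x)
    from tendsto_real_sqrt[OF this] show ?case by (simp add: tendsto_rabs_zero_iff)
  qed
  then have "(\<lambda>n. \<integral>x. av (r n) x \<partial>N) \<longlonglongrightarrow> (\<integral>x. 0 \<partial>N)"
    by (intro integral_dominated_convergence[where w = "\<lambda>_. 1"]) (auto simp: av_bound)
  moreover have "(\<integral>x. av n x \<partial>N) = measure N A - p" for n
  proof -
    have gi: "(\<integral>x. g ((R ^^ i) x) \<partial>N) = measure N A - p" for i
    proof -
      have "(\<integral>x. g x \<partial>distr N N (R ^^ i)) = (\<integral>x. g ((R ^^ i) x) \<partial>N)"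
        by (intro integral_distr measurable_compose_n[OF RN]) measurable
      then have "(\<integral>x. g ((R ^^ i) x) \<partial>N) = (\<integral>x. g x \<partial>N)"
        using distr_funpow[OF RN invN] by simp
      also have "\<dots> = measure N A - p"
        using sets.sets_into_space[OF A] spaceN
        using N.prob_space by (simp add: g_def N.emeasure_eq_measure Int_absorb2)
      finally show ?thesis .
    qed
    have "integrable N (\<lambda>x. g ((R ^^ i) x))" for i
      by (intro N.integrable_const_bound[where B = 1]) (auto simp: g_bound)
    then have "(\<integral>x. (\<Sum>i<Suc n. g ((R ^^ i) x)) \<partial>N) = (\<Sum>i<Suc n. measure N A - p)"
      by (subst Bochner_Integration.integral_sum) (auto simp only: gi)
    then show ?thesis by (simp add: av_def del: sum.lessThan_Suc of_nat_Suc)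
  qed
  ultimately show ?thesis by (simp add: p_def LIMSEQ_const_iff)
qed

context folded_map
begin

lemma emeasure_cell_vimage:
  assumes [measurable]: "A \<in> sets borel"
  shows "emeasure lborel {x \<in> cell k. T x \<in> A} = ennreal (width k) * emeasure lborel (A \<inter> {0<..l ^ (k - 1)})"
proof -
  have "emeasure lborel {x \<in> cell k. T x \<in> A} = (\<integral>\<^sup>+x. indicator {x \<in> cell k. T x \<in> A} x \<partial>lborel)"
    by simp
  also have "\<dots> = (\<integral>\<^sup>+x. indicator A (T x) * indicator (cell k) x \<partial>lborel)"
    by (intro nn_integral_cong) (auto simp: indicator_def)
  also have "\<dots> = ennreal (width k) * (\<integral>\<^sup>+x. indicator A x * indicator {0<..l ^ (k - 1)} x \<partial>lborel)"
    by (rule nn_integral_cell) measurable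
  also have "(\<integral>\<^sup>+x. indicator A x * indicator {0<..l ^ (k - 1)} x \<partial>lborel) = emeasure lborel (A \<inter> {0<..l ^ (k - 1)})"
    by (simp flip: indicator_inter_arith)
  finally show ?thesis .
qed

section \<open>Uniform re-entry into cell 0, independent of the accumulated cost\<close>

text \<open>
The time sum is compared with an integer so that subtracting the cost of one step never truncates.
\<close>

definition entry :: "nat \<Rightarrow> int \<Rightarrow> real set \<Rightarrow> real set" where
  "entry m n B = {x. (T ^^ m) x \<in> B \<and> (\<forall>i<m. (T ^^ i) x \<notin> cell 0) \<and> n < int (\<Sum>i<m. cost ((T ^^ i) x))}"

lemma entry_sets [measurable]:
  assumes [measurable]: "B \<in> sets borel"
  shows "entry m n B \<in> sets borel"
proof -
  have "(\<lambda>x. \<Sum>i<m. cost ((T ^^ i) x)) \<in> borel \<rightarrow>\<^sub>M count_space UNIV" by measurable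
  then have [measurable]: "Measurable.pred borel (\<lambda>x. n < int (\<Sum>i<m. cost ((T ^^ i) x)))"
    by (rule measurable_compose) simp
  show ?thesis unfolding entry_def by measurable
qed

lemma entry_Suc_cell:
  "x \<in> cell k \<Longrightarrow> x \<in> entry (Suc m) n B \<longleftrightarrow> k \<noteq> 0 \<and> T x \<in> entry m (n - int (S k)) B"
proof -
  assume x: "x \<in> cell k"
  then have "cost x = S k" by (simp add: in_cell_iff cost_def)
  moreover have "x \<in> cell 0 \<longleftrightarrow> k = 0" using x by (auto simp: in_cell_iff)
  ultimately show ?thesis
    by (auto simp: entry_def All_less_Suc2 sum.lessThan_Suc_shift funpow_Suc_right
        simp del: funpow.simps sum.lessThan_Suc)
qed

text \<open>Independence is carried as a cross-multiplied identity, which avoids division in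
  \<open>ennreal\<close>; these are the factor patterns of the two series below.\<close>

lemma mult_cross:
  fixes c :: "'c :: comm_semiring_1"
  assumes "c * e = e' * b"
  shows "c * (p * (w * e)) = p * (w * e') * b" "c * (w * e) = w * e' * b"
  using assms by (simp_all add: mult.left_commute[of c] mult.assoc)

text \<open>The entry point is uniform on cell 0, whatever the entry time and the cost threshold. By
  induction on m, (0, l^k] is split into cells, each of which the map spreads uniformly over an
  interval of the same form; hence all k and n are treated at once. For m = 0, (0, l^k] contains
  cell 0 if k = 0 and misses it otherwise.\<close>

lemma emeasure_entry:
  assumes [measurable]: "B \<in> sets borel" and B: "B \<subseteq> cell 0"
  shows "emeasure lborel (cell 0) * emeasure lborel (entry m n B \<inter> {0<..l ^ k}) =
    emeasure lborel (entry m n (cell 0) \<inter> {0<..l ^ k}) * emeasure lborel B"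
proof (induction m arbitrary: n k)
  case 0
  have *: "cell 0 \<inter> {0<..l ^ k} = (if k = 0 then cell 0 else {})"
    using power_le_power_iff[of k 1] l_pos by (auto simp: cell_def)
  have "entry 0 n D \<inter> {0<..l ^ k} = (if n < 0 \<and> k = 0 then D else {})" if "D \<subseteq> cell 0" for D
    using that * by (auto simp: entry_def split: if_splits)
  from this[OF B] this[of "cell 0"] show ?case by simp
next
  case (Suc m)
  have split: "emeasure lborel (entry (Suc m) n D \<inter> {0<..l ^ k}) =
      (\<Sum>j. of_bool (k + j \<noteq> 0) * (ennreal (width (k + j)) *
        emeasure lborel (entry m (n - int (S (k + j))) D \<inter> {0<..l ^ (k + j - 1)})))"
    if [measurable]: "D \<in> sets borel" for D
  proof -
    have "emeasure lborel (entry (Suc m) n D \<inter> {0<..l ^ k}) =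
        emeasure lborel (\<Union>j. entry (Suc m) n D \<inter> cell (k + j))"
      unfolding UN_cell[symmetric] by simp
    also have "\<dots> = (\<Sum>j. emeasure lborel (entry (Suc m) n D \<inter> cell (k + j)))"
      using disjoint_family_cell[of k]
      by (intro suminf_emeasure[symmetric]) (auto simp: disjoint_family_on_def)
    also have "\<dots> = (\<Sum>j. of_bool (k + j \<noteq> 0) * (ennreal (width (k + j)) *
        emeasure lborel (entry m (n - int (S (k + j))) D \<inter> {0<..l ^ (k + j - 1)})))"
    proof (rule suminf_cong)
      fix j
      have "entry (Suc m) n D \<inter> cell (k + j) =
          (if k + j = 0 then {} else {x \<in> cell (k + j). T x \<in> entry m (n - int (S (k + j))) D})"
        using entry_Suc_cell[of _ "k + j" m n D] by auto
      then show "emeasure lborel (entry (Suc m) n D \<inter> cell (k + j)) =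
          of_bool (k + j \<noteq> 0) * (ennreal (width (k + j)) *
          emeasure lborel (entry m (n - int (S (k + j))) D \<inter> {0<..l ^ (k + j - 1)}))"
        by (simp add: emeasure_cell_vimage)
    qed
    finally show ?thesis .
  qed
  show ?case
    unfolding split[OF assms(1)] split[OF cell_sets] ennreal_suminf_cmult[symmetric]
      ennreal_suminf_multc[symmetric]
    by (intro suminf_cong mult_cross(1) Suc)
qed

text \<open>The threshold is an integer so that -1 makes the cost condition vacuous, as needed for
  the invariance of \<open>unif\<close>.\<close>

definition returned_to :: "int \<Rightarrow> real set \<Rightarrow> real set" where
  "returned_to n B = {x \<in> cell 0. returns x \<and> n < int (total x) \<and> ret x \<in> B}"

lemma returned_to_sets [measurable]:
  assumes [measurable]: "B \<in> sets borel"
  shows "returned_to n B \<in> sets borel"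
proof -
  have [measurable]: "Measurable.pred borel (\<lambda>x. n < int (total x))"
    by (rule measurable_compose[OF measurable_total]) simp
  show ?thesis unfolding returned_to_def by measurable
qed

text \<open>Decomposition by the return time m + 1. The threshold drops by 1 because the first step,
  from cell 0, costs 1.\<close>

lemma returned_to_eq_UN:
  assumes "B \<subseteq> cell 0"
  shows "returned_to n B = (\<Union>m. {x \<in> cell 0. T x \<in> entry m (n - 1) B})"
proof (intro set_eqI iffI)
  fix x assume x: "x \<in> returned_to n B"
  then have r: "returns x" "x \<in> cell 0" "ret x \<in> B" "n < int (total x)" by (auto simp: returned_to_def)
  obtain m where m: "ret_time x = Suc m" using ret_time_pos[OF r(1)] by (cases "ret_time x") auto
  have "cost x = 1" using r by (simp add: in_cell_iff cost_def S_def)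
  then have "T x \<in> entry m (n - 1) B"
    using r m before_ret_time[of "Suc _" x]
    by (auto simp: entry_def ret_def total_def sum.lessThan_Suc_shift funpow_Suc_right
        simp del: funpow.simps sum.lessThan_Suc)
  with r show "x \<in> (\<Union>m. {x \<in> cell 0. T x \<in> entry m (n - 1) B})" by blast
next
  fix x assume "x \<in> (\<Union>m. {x \<in> cell 0. T x \<in> entry m (n - 1) B})"
  then obtain m where x: "x \<in> cell 0" "T x \<in> entry m (n - 1) B" by blast
  then have m: "(T ^^ Suc m) x \<in> B" "\<And>i. i < m \<Longrightarrow> (T ^^ Suc i) x \<notin> cell 0"
    "n - 1 < int (\<Sum>i<m. cost ((T ^^ Suc i) x))"
    by (auto simp: entry_def funpow_Suc_right simp del: funpow.simps)
  have r: "returns x" "ret_time x = Suc m"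
  proof -
    have "(T ^^ i) x \<notin> cell 0" if "1 \<le> i" "i < Suc m" for i
      using m(2)[of "i - 1"] that by (cases i) (auto simp del: funpow.simps)
    moreover have "(T ^^ Suc m) x \<in> cell 0" using m(1) assms by (rule subsetD[rotated])
    ultimately show "returns x" "ret_time x = Suc m"
      using ret_time_eqI[of "Suc m" x] by (simp_all del: funpow.simps)
  qed
  have "cost x = 1" using x by (simp add: in_cell_iff cost_def S_def)
  with m r x show "x \<in> returned_to n B"
    by (auto simp: returned_to_def total_def ret_def sum.lessThan_Suc_shift
        simp del: funpow.simps sum.lessThan_Suc)
qed

lemma emeasure_returned_to:
  assumes [measurable]: "B \<in> sets borel" and B: "B \<subseteq> cell 0"
  shows "emeasure lborel (cell 0) * emeasure lborel (returned_to n B) =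
    emeasure lborel (returned_to n (cell 0)) * emeasure lborel B"
proof -
  have eq: "emeasure lborel (returned_to n D) =
      (\<Sum>m. ennreal (width 0) * emeasure lborel (entry m (n - 1) D \<inter> {0<..l ^ 0}))"
    if [measurable]: "D \<in> sets borel" and D: "D \<subseteq> cell 0" for D
  proof -
    \<comment> \<open>An entry at time j rules out an earlier visit to cell 0, and D lies in cell
      0.\<close>
    have "disjoint_family (\<lambda>m. {x \<in> cell 0. T x \<in> entry m (n - 1) D})"
    proof (unfold disjoint_family_on_def, safe)
      fix i j :: nat and x assume "i \<noteq> j" "T x \<in> entry i (n - 1) D" "T x \<in> entry j (n - 1) D"
      then show "x \<in> {}"
        using D by (cases i j rule: linorder_cases) (auto simp: entry_def)
    qed
    then have "emeasure lborel (returned_to n D) = (\<Sum>m. emeasure lborel {x \<in> cell 0. T x \<in> entry m (n - 1) D})"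
      unfolding returned_to_eq_UN[OF D]
      by (intro suminf_emeasure[symmetric]) auto
    then show ?thesis by (simp add: emeasure_cell_vimage)
  qed
  show ?thesis
    unfolding eq[OF assms] eq[OF cell_sets order.refl] ennreal_suminf_cmult[symmetric]
      ennreal_suminf_multc[symmetric]
    by (intro suminf_cong mult_cross(2) emeasure_entry[OF assms])
qed

section \<open>Invariance and renewal for normalised Lebesgue measure on cell 0\<close>

definition unif :: "real measure" where
  "unif = uniform_measure lborel (cell 0)"

lemma sets_unif [simp, measurable_cong]: "sets unif = sets borel" and space_unif [simp]: "space unif = UNIV"
  by (simp_all add: unif_def)

lemma emeasure_cell_0: "emeasure lborel (cell 0) = ennreal (1 - l)"
  by (simp add: emeasure_cell)

lemma prob_space_unif: "prob_space unif"
  unfolding unif_def using l_less_1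
  by (intro prob_space_uniform_measure) (auto simp: emeasure_cell_0 ennreal_eq_0_iff)

lemma emeasure_unif:
  "A \<in> sets borel \<Longrightarrow> emeasure unif A = emeasure lborel (cell 0 \<inter> A) / ennreal (1 - l)"
  by (simp add: unif_def emeasure_uniform_measure emeasure_cell_0)

lemma emeasure_mult_div_cell:
  assumes "ennreal (1 - l) * x = y * z"
  shows "x / ennreal (1 - l) = (y / ennreal (1 - l)) * (z / ennreal (1 - l))"
proof -
  let ?c = "ennreal (1 - l)"
  have c: "?c \<noteq> 0" "?c \<noteq> \<top>" using l_less_1 by (auto simp: ennreal_eq_0_iff)
  have "x = (?c * x) / ?c" using c by (metis ennreal_mult_divide_eq mult.commute)
  then have "x / ?c = (y * z) / ?c / ?c" using assms by simp
  also have "\<dots> = (y / ?c) * (z / ?c)"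
    by (simp add: divide_ennreal_def mult_ac)
  finally show ?thesis .
qed

text \<open>The threshold -1 imposes no cost condition, so almost sure return and uniform re-entry
  give the invariance.\<close>

lemma distr_unif_ret: "distr unif unif ret = unif"
proof (rule measure_eqI)
  fix B assume "B \<in> sets (distr unif unif ret)"
  then have [measurable]: "B \<in> sets borel" by simp
  have "emeasure (distr unif unif ret) B = emeasure unif (ret -` B)"
    by (subst emeasure_distr) auto
  also have "\<dots> = emeasure lborel (returned_to (- 1) (cell 0 \<inter> B)) / ennreal (1 - l)"
  proof -
    have "ret -` B \<in> sets borel" using measurable_sets[OF measurable_ret, of B] by simp
    moreover have "emeasure lborel (cell 0 \<inter> ret -` B) = emeasure lborel (returned_to (- 1) (cell 0 \<inter> B))"
    proof (rule emeasure_eq_AE)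
      show "AE x in lborel. x \<in> cell 0 \<inter> ret -` B \<longleftrightarrow> x \<in> returned_to (- 1) (cell 0 \<inter> B)"
        using AE_returns by eventually_elim (auto simp: returned_to_def ret_in_cell)
      show "cell 0 \<inter> ret -` B \<in> sets lborel" using calculation by simp
      show "returned_to (- 1) (cell 0 \<inter> B) \<in> sets lborel" by measurable
    qed
    ultimately show ?thesis by (simp add: emeasure_unif)
  qed
  also have "\<dots> = emeasure unif B"
  proof -
    have "emeasure lborel (returned_to (- 1) (cell 0)) = emeasure lborel (cell 0)"
    proof (rule emeasure_eq_AE)
      show "AE x in lborel. x \<in> returned_to (- 1) (cell 0) \<longleftrightarrow> x \<in> cell 0"
        using AE_returns by eventually_elim (auto simp: returned_to_def ret_in_cell)
      show "returned_to (- 1) (cell 0) \<in> sets lborel" by measurable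
    qed simp
    then have "emeasure lborel (returned_to (- 1) (cell 0 \<inter> B)) = emeasure lborel (cell 0 \<inter> B)"
      using emeasure_returned_to[of "cell 0 \<inter> B" "- 1"] l_less_1
      by (simp add: emeasure_cell_0 ennreal_mult_cancel_left ennreal_eq_0_iff)
    then show ?thesis by (simp add: emeasure_unif)
  qed
  finally show "emeasure (distr unif unif ret) B = emeasure unif B" .
qed simp

text \<open>A point of \<open>tail n\<close> returns, so both events are instances of
  \<open>returned_to\<close>, and uniform re-entry factorises them.\<close>

lemma unif_renewal:
  assumes [measurable]: "B \<in> sets unif"
  shows "measure unif (tail n \<inter> (ret -` B \<inter> space unif)) = measure unif (tail n) * measure unif B"
proof -
  interpret prob_space unif by (rule prob_space_unif)
  have r: "ret -` B \<in> sets borel" using measurable_sets[OF measurable_ret, of B] assms by simp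
  have "cell 0 \<inter> (tail n \<inter> ret -` B) = returned_to (int n) (cell 0 \<inter> B)"
    using returns_if_total[of n] by (auto simp: returned_to_def tail_def ret_in_cell)
  moreover have "cell 0 \<inter> tail n = returned_to (int n) (cell 0)"
    using returns_if_total[of n] by (auto simp: returned_to_def tail_def ret_in_cell)
  ultimately have "emeasure unif (tail n \<inter> ret -` B) = emeasure unif (tail n) * emeasure unif B"
    using emeasure_mult_div_cell[OF emeasure_returned_to[of "cell 0 \<inter> B" "int n", unfolded emeasure_cell_0]] r assms
    by (simp add: emeasure_unif)
  then show ?thesis
    by (simp add: emeasure_eq_measure measure_nonneg flip: ennreal_mult)
qed

lemma measure_unif_tail: "measure unif (tail n) = measure lborel (tail n) / (1 - l)"
proof -
  interpret prob_space unif by (rule prob_space_unif)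
  have "cell 0 \<inter> tail n = tail n" by (auto simp: tail_def)
  then have "ennreal (measure unif (tail n)) = ennreal (measure lborel (tail n)) / ennreal (1 - l)"
    using emeasure_unif[of "tail n"] tail_fmeasurable by (simp add: emeasure_eq_measure emeasure_eq_measure2)
  then show ?thesis using l_less_1 by (simp add: divide_ennreal)
qed

end

section \<open>From the Fibonacci map to the folded map\<close>

lemma S_bounds:
  assumes G: "G = (1 + sqrt 5) / 2"
  shows "G ^ k \<le> real (S k) \<and> real (S k) \<le> G ^ Suc k"
proof (induction k rule: fib.induct)
  case 1
  have "1 \<le> sqrt 5" by simp
  then show ?case by (simp add: S_def G)
next
  case 2
  have "sqrt 5 \<le> 3" "2 \<le> sqrt 5" by (simp_all add: real_le_rsqrt real_le_lsqrt)
  then show ?case by (simp add: S_def G numeral_eq_Suc field_simps)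
next
  case (3 k)
  have G2: "G ^ 2 = G + 1" by (simp add: G power2_eq_square field_simps)
  \<comment> \<open>Powers of G obey the Fibonacci recursion, so both bounds propagate from the
    starting values 1 and 2.\<close>
  have pow: "G ^ Suc (Suc j) = G ^ Suc j + G ^ j" for j
  proof -
    have "G ^ Suc (Suc j) = G ^ j * G ^ 2" by (simp add: power2_eq_square)
    then show ?thesis unfolding G2 by (simp add: algebra_simps)
  qed
  have "real (S (Suc (Suc k))) = real (S (Suc k)) + real (S k)" by (simp add: S_def)
  with 3 show ?case unfolding pow[of k] pow[of "Suc k"] by linarith
qed

lemma ex_power_bracket:
  fixes G x :: real
  assumes "1 < G" "1 \<le> x"
  obtains K where "G ^ K \<le> x" "x < G ^ Suc K"
proof -
  define N where "N = (LEAST N. x < G ^ N)"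
  have N: "x < G ^ N" unfolding N_def using real_arch_pow[OF assms(1)] by (rule LeastI_ex)
  then obtain K where K: "N = Suc K" using assms(2) by (cases N) auto
  have "\<not> x < G ^ K" using not_less_Least[of K "\<lambda>N. x < G ^ N"] K by (simp add: N_def)
  with N K that[of K] show ?thesis by simp
qed

context folded_map
begin

text \<open>K is chosen with G^K <= n < G^(K+1), so that n^(-beta) lies between q^(K+1) and q^K for
  q = \<open>ratio\<close>. Since G q > 1, the truncated cost sum is geometric and dominated by its
  last terms, of order (G q)^K <= n q^K.\<close>

lemma measure_tail_bounds:
  assumes G: "G = (1 + sqrt 5) / 2" and Gr: "1 < G * ratio" and \<beta>: "ratio = G powr - \<beta>" and "0 < \<beta>"
  obtains D1 D2 where "0 < D2" "\<And>n. 1 \<le> n \<Longrightarrow> D2 * real n powr - \<beta> \<le> measure lborel (tail n)"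
    "\<And>n. 1 \<le> n \<Longrightarrow> measure lborel (tail n) \<le> D1 * real n powr - \<beta>"
proof -
  \<comment> \<open>\<open>D1\<close> adds the geometric-sum constant for levels below K to the one
    for levels from K on; the final division by \<open>ratio\<close> turns q^K into q^(K+1). The
    square in \<open>D2\<close> comes from using the lower bound at level K + 1.\<close>
  define D1 where "D1 = (1 - l) * (G / (G * ratio - 1) + 1 / (1 - ratio)) / ratio"
  define D2 where "D2 = (1 - l) * (1 / ratio - 1) * ratio ^ 2"
  have "1 < sqrt 5" by simp
  then have G1: "1 < G" by (simp add: G)
  note r = ratio_pos ratio_less_1
  have ratio_power: "ratio ^ k = (G ^ k) powr - \<beta>" for k
    using G1 by (simp add: \<beta> powr_powr powr_realpow[symmetric] mult.commute)
  have lower: "D2 * real n powr - \<beta> \<le> measure lborel (tail n)"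
    and upper: "measure lborel (tail n) \<le> D1 * real n powr - \<beta>" if n: "1 \<le> n" for n
  proof -
    obtain K where K: "G ^ K \<le> real n" "real n < G ^ Suc K"
      using ex_power_bracket[OF G1, of "real n"] n by auto
    have GK: "0 < G ^ K" using G1 by simp
    have le: "real n powr - \<beta> \<le> ratio ^ K"
      unfolding ratio_power using K(1) GK \<open>0 < \<beta>\<close> by (intro powr_mono2') auto
    have ge: "ratio ^ Suc K \<le> real n powr - \<beta>"
      unfolding ratio_power using K(2) n \<open>0 < \<beta>\<close> by (intro powr_mono2') auto
    \<comment> \<open>Level K + 1 is the first one guaranteed to have cost at least n.\<close>
    have "n \<le> S (Suc K)"
      using S_bounds[OF G, of "Suc K"] K(2) by linarith
    have "D2 * real n powr - \<beta> \<le> D2 * ratio ^ K"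
      using le r l_less_1 by (intro mult_left_mono) (auto simp: D2_def)
    also have "\<dots> = (1 - l) * (1 / ratio - 1) * ratio ^ Suc (Suc K)"
      by (simp add: D2_def power2_eq_square)
    also have "\<dots> \<le> measure lborel (tail (S (Suc K)))"
      by (rule measure_tail_ge) simp
    also have "\<dots> \<le> measure lborel (tail n)"
      using \<open>n \<le> S (Suc K)\<close> tail_fmeasurable by (intro measure_mono_fmeasurable) (auto simp: tail_def)
    finally show "D2 * real n powr - \<beta> \<le> measure lborel (tail n)" .
    have "(\<Sum>k<K. S k * ratio ^ k) \<le> (\<Sum>k<K. G * (G * ratio) ^ k)"
    proof (rule sum_mono)
      fix k
      have "S k * ratio ^ k \<le> G ^ Suc k * ratio ^ k"
        using S_bounds[OF G, of k] r by (intro mult_right_mono) auto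
      then show "S k * ratio ^ k \<le> G * (G * ratio) ^ k" by (simp add: power_mult_distrib mult.assoc)
    qed
    also have "\<dots> = G * (((G * ratio) ^ K - 1) / (G * ratio - 1))"
      using Gr by (simp add: geometric_sum flip: sum_distrib_left)
    also have "\<dots> \<le> G * ((G * ratio) ^ K / (G * ratio - 1))"
      using Gr G1 by (intro mult_left_mono divide_right_mono) auto
    also have "\<dots> = G / (G * ratio - 1) * ratio ^ K * G ^ K"
      by (simp add: power_mult_distrib)
    also have "\<dots> \<le> G / (G * ratio - 1) * ratio ^ K * real n"
      using Gr G1 r K by (intro mult_left_mono) auto
    finally have "(\<Sum>k<K. S k * ratio ^ k) / n \<le> G / (G * ratio - 1) * ratio ^ K"
      using n by (simp add: pos_divide_le_eq)
    then have "(1 - l) * ((\<Sum>k<K. S k * ratio ^ k) / n + ratio ^ K / (1 - ratio)) \<le>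
        (1 - l) * (G / (G * ratio - 1) * ratio ^ K + ratio ^ K / (1 - ratio))"
      using l_less_1 by (intro mult_left_mono add_right_mono) auto
    also have "\<dots> = D1 * ratio ^ Suc K"
      using r by (simp add: D1_def field_simps)
    also have "\<dots> \<le> D1 * real n powr - \<beta>"
      using ge r Gr G1 l_less_1 by (intro mult_left_mono) (auto simp: D1_def)
    finally show "measure lborel (tail n) \<le> D1 * real n powr - \<beta>"
      using measure_tail_le[OF n, of K] by linarith
  qed
  have "0 < D2" using r l_less_1 by (simp add: D2_def)
  from that[OF this lower upper] show ?thesis .
qed

end

section \<open>Folding at the critical point\<close>

definition fold_at_crit :: "real \<Rightarrow> real" where
  "fold_at_crit y = \<bar>2 * y - 1\<bar>"

lemma measurable_fold_at_crit [measurable]: "fold_at_crit \<in> borel_measurable borel"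
  unfolding fold_at_crit_def[abs_def] by measurable

text \<open>The preimage is covered by the preimages under the two affine maps 2 y - 1 and 1 - 2
  y.\<close>

lemma null_vimage_fold_at_crit:
  assumes A: "A \<in> null_sets lborel"
  shows "fold_at_crit -` A \<in> null_sets lborel"
proof -
  have [measurable]: "A \<in> sets borel" using A by (auto simp: null_sets_def)
  have [measurable]: "fold_at_crit -` A \<in> sets borel"
    using measurable_sets[OF measurable_fold_at_crit, of A] by simp
  have half: "(\<integral>\<^sup>+y. indicator A (t + c * y) \<partial>lborel) = (0::ennreal)" if "c \<noteq> 0" for t c :: real
  proof -
    have "(\<integral>\<^sup>+y. indicator A y \<partial>lborel) = (0::ennreal)" using A by (simp add: null_sets_def)
    then show ?thesis
      using nn_integral_real_affine[of "indicator A" c t] that by simp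
  qed
  have "emeasure lborel (fold_at_crit -` A) = (\<integral>\<^sup>+y. indicator (fold_at_crit -` A) y \<partial>lborel)"
    by simp
  also have "\<dots> \<le> (\<integral>\<^sup>+y. indicator A (-1 + 2 * y) + indicator A (1 + (-2) * y) \<partial>lborel)"
    by (intro nn_integral_mono) (auto simp: indicator_def fold_at_crit_def abs_if split: if_splits)
  also have "\<dots> = 0"
    using half[of 2 "-1"] half[of "-2" 1] by (subst nn_integral_add) auto
  finally show ?thesis by (simp add: null_sets_def)
qed

text \<open>The value c is attained at some w, and by monotonicity c = g w lies between g u and g c.
  As g u also lies between c and g c, it must equal c.\<close>

lemma monotone_onto_endpoint:
  assumes "monotone_onto g A (closed_segment c (g c))"
    and "u \<in> A" "c \<in> A" and "(\<forall>w\<in>A. u \<le> w \<and> w \<le> c) \<or> (\<forall>w\<in>A. c \<le> w \<and> w \<le> u)"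
  shows "g u = c"
proof -
  have im: "g ` A = closed_segment c (g c)" and mono: "mono_on A g \<or> antimono_on A g"
    using assms(1) by (auto simp: monotone_onto_def)
  obtain w where w: "w \<in> A" "g w = c" using im by (metis ends_in_segment(1) imageE)
  have "g u \<in> closed_segment c (g c)" using im assms(2) by blast
  moreover have "(g u \<le> g w \<and> g w \<le> g c) \<or> (g c \<le> g w \<and> g w \<le> g u)"
    using mono assms(2-4) w(1) by (auto simp: monotone_on_def)
  ultimately show ?thesis
    using w(2) by (auto simp: closed_segment_eq_real_ivl split: if_splits)
qed

locale pl_fibonacci_map = folded_map l for l :: real +
  fixes a b :: real and f :: "real \<Rightarrow> real" and z zh :: "nat \<Rightarrow> real"
  assumes pl: "pl_fibonacci l a b f z zh"
begin

lemma fib_unimodal: "fibonacci_unimodal a b f z zh"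
  using pl by (simp add: pl_fibonacci_def)

lemma z_eq: "z k = 1/2 - l ^ k / 2"
proof -
  have step: "z k < z (Suc k)" and lim: "z \<longlonglongrightarrow> crit" for k
    using fib_unimodal by (auto simp: fibonacci_unimodal_def)
  have "z (Suc k) \<le> crit"
    using step by (intro incseq_le[OF _ lim] incseq_SucI) (simp add: less_imp_le)
  then have "z k < crit" using step[of k] by linarith
  moreover have "\<bar>z k - crit\<bar> = l ^ k / 2" using pl by (simp add: pl_fibonacci_def)
  ultimately show ?thesis by (simp add: crit_def)
qed

lemma zh_eq: "zh k = 1/2 + l ^ k / 2"
proof -
  have step: "zh (Suc k) < zh k" and lim: "zh \<longlonglongrightarrow> crit" for k
    using fib_unimodal by (auto simp: fibonacci_unimodal_def)
  have "crit \<le> zh (Suc k)"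
    using step by (intro decseq_ge[OF _ lim] decseq_SucI) (simp add: less_imp_le)
  then have "crit < zh k" using step[of k] by linarith
  moreover have "\<bar>zh k - crit\<bar> = l ^ k / 2" using pl by (simp add: pl_fibonacci_def)
  ultimately show ?thesis by (simp add: crit_def)
qed

lemma left_iff: "y \<in> {z k..<z (k + 1)} \<longleftrightarrow> fold_at_crit y \<in> cell k \<and> y < 1/2"
  using zero_less_power[OF l_pos, of k] zero_less_power[OF l_pos, of "Suc k"]
  by (auto simp: z_eq cell_def fold_at_crit_def field_simps abs_if simp del: zero_less_power)

lemma right_iff: "y \<in> {zh (k + 1)<..zh k} \<longleftrightarrow> fold_at_crit y \<in> cell k \<and> 1/2 < y"
  using zero_less_power[OF l_pos, of k] zero_less_power[OF l_pos, of "Suc k"]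
  by (auto simp: zh_eq cell_def fold_at_crit_def field_simps abs_if simp del: zero_less_power)

lemma Vhat_iff: "y \<in> Vhat z zh (Suc k) \<longleftrightarrow> fold_at_crit y \<in> cell k"
proof -
  have "fold_at_crit y \<in> cell k \<Longrightarrow> y \<noteq> 1/2"
    by (auto simp: in_cell_iff fold_at_crit_def)
  then show ?thesis
    using left_iff[of y k] right_iff[of y k] by (auto simp: Vhat_def)
qed

lemma sigma_eq: "sigma z zh y = cost (fold_at_crit y)"
proof (cases "0 < fold_at_crit y \<and> fold_at_crit y \<le> 1")
  case True
  then have "(\<exists>k. y \<in> Vhat z zh (k + 1))" "(THE k. y \<in> Vhat z zh (k + 1)) = level (fold_at_crit y)"
    by (auto simp: Vhat_iff in_cell_iff)
  with True show ?thesis by (simp add: sigma_def cost_def)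
qed (auto simp: sigma_def cost_def Vhat_iff in_cell_iff)

lemma induced_map_z: "induced_map f z zh (z k) = 1/2"
  and induced_map_zh: "induced_map f z zh (zh k) = 1/2"
proof -
  have p: "0 < l ^ k" "l ^ k \<le> 1" using l_pos power_le_1 by auto
  have c: "fold_at_crit (z k) \<in> cell k" "fold_at_crit (zh k) \<in> cell k"
    using p l_pos l_less_1 by (auto simp: fold_at_crit_def z_eq zh_eq cell_def)
  then have s: "sigma z zh (z k) = S k" "sigma z zh (zh k) = S k"
    by (auto simp: sigma_eq in_cell_iff cost_def)
  have m: "monotone_onto (f ^^ S k) {z k..crit} (closed_segment crit ((f ^^ S k) crit))"
    "monotone_onto (f ^^ S k) {crit..zh k} (closed_segment crit ((f ^^ S k) crit))"
    using fib_unimodal by (auto simp: fibonacci_unimodal_def)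
  have "(f ^^ S k) (z k) = crit" "(f ^^ S k) (zh k) = crit"
    by (rule monotone_onto_endpoint[OF m(1)] monotone_onto_endpoint[OF m(2)];
        use p in \<open>auto simp: z_eq zh_eq crit_def\<close>)+
  then show "induced_map f z zh (z k) = 1/2" "induced_map f z zh (zh k) = 1/2"
    by (simp_all add: induced_map_def s crit_def)
qed

text \<open>On each branch the outer endpoint is sent to the critical point, so the distance of the
  image from the critical point is the absolute slope times the distance to that endpoint. Folding
  forgets the sign of the slope and the side.\<close>

lemma fold_induced_map: "fold_at_crit (induced_map f z zh y) = T (fold_at_crit y)"
proof (cases "0 < fold_at_crit y \<and> fold_at_crit y \<le> 1")
  case False
  then show ?thesis by (auto simp: induced_map_def sigma_eq cost_def T_def)
next
  case True
  define k where "k = level (fold_at_crit y)"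
  have cell: "fold_at_crit y \<in> cell k" using True by (simp add: k_def in_cell_iff)
  have y: "y \<noteq> 1/2" using True by (auto simp: fold_at_crit_def)
  have p: "0 < l ^ k" "l ^ k \<le> 1" using l_pos power_le_1 by auto
  have c: "fold_at_crit (z k) \<in> cell k" "fold_at_crit (zh k) \<in> cell k"
    using p l_pos l_less_1 by (auto simp: fold_at_crit_def z_eq zh_eq cell_def)
  define J u where "J = (if y < 1/2 then {z k..<z (k + 1)} else {zh (k + 1)<..zh k})"
    and "u = (if y < 1/2 then z k else zh k)"
  have J: "y \<in> J" "u \<in> J"
    using y cell c p left_iff[of y k] right_iff[of y k] left_iff[of "z k" k] right_iff[of "zh k" k]
    by (auto simp: J_def u_def z_eq[of k] zh_eq[of k])
  have "J \<in> {{z k..<z (k + 1)}, {zh (k + 1)<..zh k}}" by (simp add: J_def)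
  then obtain s where s: "\<bar>s\<bar> = (if k = 0 then 1 / (1 - l) else 1 / (l * (1 - l)))"
    "linear_with_slope s (induced_map f z zh) J"
    using pl unfolding pl_fibonacci_def by meson
  then obtain t where "\<forall>x\<in>J. induced_map f z zh x = s * x + t"
    by (auto simp: linear_with_slope_def)
  with J have "induced_map f z zh y - induced_map f z zh u = s * (y - u)"
    by (simp add: algebra_simps)
  moreover have "induced_map f z zh u = 1/2" by (simp add: u_def induced_map_z induced_map_zh)
  ultimately have "fold_at_crit (induced_map f z zh y) = \<bar>2 * (s * (y - u))\<bar>"
    by (simp add: fold_at_crit_def)
  also have "\<dots> = \<bar>s\<bar> * (2 * \<bar>y - u\<bar>)" by (simp add: abs_mult)
  also have "\<bar>s\<bar> = 1 / width k" by (simp add: s width_def)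
  also have "2 * \<bar>y - u\<bar> = l ^ k - fold_at_crit y"
    using cell y by (auto simp: u_def z_eq zh_eq cell_def fold_at_crit_def abs_if field_simps split: if_splits)
  finally show ?thesis using True by (simp add: T_def k_def)
qed

lemma fold_induced_map_funpow:
  "fold_at_crit ((induced_map f z zh ^^ n) y) = (T ^^ n) (fold_at_crit y)"
  by (induction n) (simp_all add: fold_induced_map)

lemma rho_eq: "rho f z zh y = ret_time (fold_at_crit y)"
  unfolding rho_def ret_time_def returns_def One_nat_def Vhat_iff fold_induced_map_funpow ..

lemma tau_eq: "tau f z zh y = total (fold_at_crit y)"
  by (simp add: tau_def total_def rho_eq sigma_eq fold_induced_map_funpow)

lemma fold_return_map: "fold_at_crit (return_map f z zh y) = ret (fold_at_crit y)"
  by (simp add: return_map_def ret_def rho_eq fold_induced_map_funpow)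

text \<open>The image of \<open>mu\<close> under folding is invariant under \<open>ret\<close> and
  absolutely continuous with respect to \<open>unif\<close>, so \<open>measure_eq_if_renewal\<close>
  fixes its value on \<open>tail n\<close>. The event is a folding preimage because
  \<open>tau\<close> depends on the folded point only.\<close>

lemma measure_tau_tail:
  assumes mu: "acip (Vhat z zh 1) (return_map f z zh) mu"
  shows "measure mu {y \<in> Vhat z zh 1. tau f z zh y > n} = measure unif (tail n)"
proof -
  let ?V = "Vhat z zh 1"
  define N where "N = distr mu borel fold_at_crit"
  have V: "?V = fold_at_crit -` cell 0" using Vhat_iff[of _ 0] by auto
  have Vs: "?V \<in> sets borel"
    unfolding V using measurable_sets[OF measurable_fold_at_crit cell_sets] by simp
  have pm: "prob_space mu" and sets: "sets mu = sets (restrict_space lborel ?V)"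
    and ac: "absolutely_continuous (restrict_space lborel ?V) mu"
    and R: "return_map f z zh \<in> measurable mu mu" and inv: "distr mu mu (return_map f z zh) = mu"
    using mu by (auto simp: acip_def)
  interpret mu: prob_space mu by fact
  have space: "space mu = ?V"
    using sets_eq_imp_space_eq[OF sets] by (simp add: space_restrict_space)
  have fold_mu [measurable]: "fold_at_crit \<in> measurable mu borel"
    unfolding measurable_cong_sets[OF sets refl] by (rule measurable_restrict_space1) simp
  have sN [measurable_cong, simp]: "sets N = sets borel" by (simp add: N_def)
  have pN: "prob_space N" unfolding N_def by (rule mu.prob_space_distr) measurable
  have invN: "distr N N ret = N"
  proof -
    have "distr N N ret = distr N borel ret" by (intro distr_cong) auto
    also have "\<dots> = distr mu borel (ret \<circ> fold_at_crit)"
      unfolding N_def by (rule distr_distr) measurable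
    also have "ret \<circ> fold_at_crit = fold_at_crit \<circ> return_map f z zh"
      by (auto simp: fold_return_map)
    also have "distr mu borel (fold_at_crit \<circ> return_map f z zh) = distr (distr mu mu (return_map f z zh)) borel fold_at_crit"
      using R by (intro distr_distr[symmetric]) measurable
    finally show ?thesis by (simp only: inv N_def)
  qed
  have acN: "absolutely_continuous unif N"
    unfolding absolutely_continuous_def
  proof
    fix A assume A: "A \<in> null_sets unif"
    then have As [measurable]: "A \<in> sets borel" by (auto simp: null_sets_def)
    have "emeasure lborel (cell 0 \<inter> A) = 0"
      using A As emeasure_unif[of A] by (auto simp: null_sets_def ennreal_divide_eq_0_iff)
    then have "cell 0 \<inter> A \<in> null_sets lborel" by (simp add: null_sets_def)
    then have "fold_at_crit -` (cell 0 \<inter> A) \<in> null_sets lborel" by (rule null_vimage_fold_at_crit)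
    then have "fold_at_crit -` (cell 0 \<inter> A) \<in> null_sets (restrict_space lborel ?V)"
      using Vs by (subst null_sets_restrict_space) (auto simp: Vhat_iff)
    then have "fold_at_crit -` (cell 0 \<inter> A) \<in> null_sets mu"
      using ac by (auto simp: absolutely_continuous_def)
    moreover have "fold_at_crit -` A \<inter> space mu = fold_at_crit -` (cell 0 \<inter> A)"
      by (auto simp: space Vhat_iff)
    ultimately show "A \<in> null_sets N"
      by (simp add: null_sets_def N_def emeasure_distr)
  qed
  have ts: "tail n \<in> sets borel" by measurable
  have "measure N (tail n) = measure unif (tail n)"
  proof (rule measure_eq_if_renewal[OF prob_space_unif pN _ acN _ distr_unif_ret invN])
    show "sets N = sets unif" by simp
    show "ret \<in> unif \<rightarrow>\<^sub>M unif" by measurable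
    show "tail n \<in> sets unif" using ts by simp
  qed (rule unif_renewal)
  moreover have "measure N (tail n) = measure mu (fold_at_crit -` tail n \<inter> space mu)"
    unfolding N_def using ts by (intro measure_distr) auto
  moreover have "fold_at_crit -` tail n \<inter> space mu = {y \<in> ?V. tau f z zh y > n}"
    by (auto simp: space Vhat_iff tail_def tau_eq)
  ultimately show ?thesis by simp
qed

end

theorem theorem8p15:
  fixes G lam beta a b :: real
    and f :: "real \<Rightarrow> real"
    and z zh :: "nat \<Rightarrow> real"
    and mu :: "real measure"
  assumes "G = (1 + sqrt 5) / 2"
    and "lam \<in> {2 / (3 + sqrt 5)<..<1/2}"
    and "beta = ln ((1 - lam) / lam) / ln G"
    and "pl_fibonacci lam a b f z zh"
    and "acip (Vhat z zh 1) (return_map f z zh) mu"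
  shows "beta \<in> {0<..<1} \<and>
    (\<exists>C1 C2 :: real. 0 < C2 \<and> C2 < C1 \<and>
      (\<forall>n::nat. n \<ge> 1 \<longrightarrow>
         C2 * real n powr (- beta) \<le> measure mu {y \<in> Vhat z zh 1. tau f z zh y > n} \<and>
         measure mu {y \<in> Vhat z zh 1. tau f z zh y > n} \<le> C1 * real n powr (- beta)))"
proof
  have "0 < 2 / (3 + sqrt 5)" by (simp add: add_pos_pos)
  also have "\<dots> < lam" using assms(2) by simp
  finally have l: "0 < lam" "lam < 1/2" "2 / (3 + sqrt 5) < lam" using assms(2) by auto
  interpret pl_fibonacci_map lam a b f z zh
    by unfold_locales (use l assms(4) in auto)
  have G1: "1 < G" by (simp add: assms(1))
  \<comment> \<open>The lower end of the parameter range is 1/(1 + G); exceeding it amounts to G q >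
    1 for q = \<open>ratio\<close>, that is, to beta < 1.\<close>
  have "2 / (3 + sqrt 5) = 1 / (1 + G)" by (simp add: assms(1) field_simps)
  then have "1 < lam * (1 + G)" using l(3) G1 by (simp add: divide_less_eq)
  then have Gr: "1 < G * ratio" using l by (simp add: ratio_def field_simps)
  have inv_ratio: "(1 - lam) / lam = 1 / ratio" by (simp add: ratio_def)
  have lnG: "0 < ln G" using G1 by simp
  have beta0: "0 < beta"
    unfolding assms(3) inv_ratio using ratio_pos ratio_less_1 lnG by simp
  have "1 / ratio < G" using Gr ratio_pos by (simp add: field_simps)
  then have "ln (1 / ratio) < ln G" using ratio_pos G1 by (subst ln_less_cancel_iff) auto
  then have beta1: "beta < 1" unfolding assms(3) inv_ratio using lnG by simp
  show "beta \<in> {0<..<1}" using beta0 beta1 by simp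
  have "- beta * ln G = ln ratio"
    unfolding assms(3) inv_ratio using lnG ratio_pos by (simp add: ln_div)
  then have rb: "ratio = G powr - beta" using ratio_pos G1 by (simp add: powr_def)
  obtain D2 D1 where D: "0 < D2"
    "\<And>n. 1 \<le> n \<Longrightarrow> D2 * real n powr - beta \<le> measure lborel (tail n)"
    "\<And>n. 1 \<le> n \<Longrightarrow> measure lborel (tail n) \<le> D1 * real n powr - beta"
    by (rule measure_tail_bounds[OF assms(1) Gr rb beta0]) (rule that)
  have eq: "measure mu {y \<in> Vhat z zh 1. tau f z zh y > n} = measure lborel (tail n) / (1 - lam)" for n
    using measure_tau_tail[OF assms(5)] measure_unif_tail by simp
  show "\<exists>C1 C2 :: real. 0 < C2 \<and> C2 < C1 \<and>
      (\<forall>n::nat. n \<ge> 1 \<longrightarrow>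
         C2 * real n powr (- beta) \<le> measure mu {y \<in> Vhat z zh 1. tau f z zh y > n} \<and>
         measure mu {y \<in> Vhat z zh 1. tau f z zh y > n} \<le> C1 * real n powr (- beta))"
  proof (intro exI conjI allI impI)
    show "0 < D2 / (1 - lam)" using D(1) l by simp
    \<comment> \<open>Enlarging \<open>D1\<close> to \<open>\<bar>D1\<bar> + D2 + 1\<close> forces
      the strict order of the constants; the factor 1/(1 - lam) normalises by the length of cell
      0.\<close>
    show "D2 / (1 - lam) < (\<bar>D1\<bar> + D2 + 1) / (1 - lam)" using l by (intro divide_strict_right_mono) auto
    fix n :: nat assume n: "1 \<le> n"
    show "D2 / (1 - lam) * real n powr - beta \<le> measure mu {y \<in> Vhat z zh 1. tau f z zh y > n}"
      unfolding eq using D(2)[OF n] l by (simp add: divide_right_mono)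
    have "D1 * real n powr - beta \<le> (\<bar>D1\<bar> + D2 + 1) * real n powr - beta"
      using D(1) by (intro mult_right_mono) auto
    with D(3)[OF n] show "measure mu {y \<in> Vhat z zh 1. tau f z zh y > n} \<le>
        (\<bar>D1\<bar> + D2 + 1) / (1 - lam) * real n powr - beta"
      unfolding eq times_divide_eq_left using l by (intro divide_right_mono) auto
  qed
qed

end
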